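(* Let $N=2^n$, $T\ge1$, $\epsilon>0$, $\delta\in(0,1)$, $\lambda\in(0,1]$, and let $\mathcal A$ be an analyst that is an $(\epsilon/16,\lambda,U_{[N]})$-pseudodense challenger. Then the mechanism $\mathcal M_{\mathrm{AQA\text{-}OGD}}$ run with parameters $\epsilon,\delta,\lambda$ is $(\epsilon,\delta)$-accurate with respect to $\mathcal A$ for any sample size $$M\ge\frac{4096}{\lambda^2\epsilon^4}\log(T/\epsilon)+\frac{32}{\epsilon^2}\log(10/\delta);$$ that is, for every such $M$, in the adaptive query game between $\mathcal A$ and $\mathcal M_{\mathrm{AQA\text{-}OGD}}$ with $T$ rounds and $M$ samples, $$\Pr\left[\forall t\in\{1,\dots,T\}:\ |a_t-q_t(\mathcal D)|\le\epsilon\right]\ge1-\delta .$$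
   Context: Notation: $[N]=\{1,\dots,N\}$; $U_{[N]}$ is the uniform distribution on $[N]$; for $q:[N]\to\mathbb R$ and a distribution $\mathcal D$ on $[N]$, $q(\mathcal D)=\mathbb E_{i\sim\mathcal D}[q(i)]$; for a finite multiset $S$ of elements of $[N]$, $q(S)=\frac1{|S|}\sum_{i\in S}q(i)$ (with multiplicity); $\mathrm{sign}(x)=1$ if $x\ge0$, $-1$ otherwise; $\log$ is the natural logarithm. Adaptive query game: the (possibly randomized) analyst $\mathcal A$ chooses a distribution $\mathcal D$ over $[N]$ unknown to the mechanism; a multiset $S$ of $M$ i.i.d. samples from $\mathcal D$ is given to the mechanism but not to $\mathcal A$; in each round $t=1,\dots,T$, $\mathcal A$ chooses a query $q_t\in\{-1,1\}^{N}$ (a function $[N]\to\{-1,1\}$) given $(q_1,a_1,\dots,q_{t-1},a_{t-1})$, and the mechanism outputs an answer $a_t$. Probabilities are over the sample and the internal randomness of both parties. Pseudodense: a distribution $\mathcal D'$ on $[N]$ is $(\lambda,U_{[N]})$-dense if $\Pr_{I\sim\mathcal D'}[I=i]\le\frac1{\lambda N}$ for all $i\in[N]$. Let $\mathcal Q^{\mathcal A}\subseteq\{-1,1\}^N$ be the set of all queries that $\mathcal A$ may output at any point, on any input and under any internal randomness. $\mathcal D$ is $(\epsilon',\lambda,U_{[N]})$-pseudodense with respect to $\mathcal A$ if there is a $(\lambda,U_{[N]})$-dense distribution $\mathcal D'$ with $|q(\mathcal D)-q(\mathcal D')|\le\epsilon'$ for all $q\in\mathcal Q^{\mathcal A}$.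 $\mathcal A$ is an $(\epsilon',\lambda,U_{[N]})$-pseudodense challenger if it almost surely selects a distribution $\mathcal D$ that is $(\epsilon',\lambda,U_{[N]})$-pseudodense with respect to $\mathcal A$. Subroutine $\mathrm{IP}_{\mathrm{est}}(q,\mathcal G;\eta,\rho)$, for $q\in\{-1,1\}^N$ and a finite multiset $\mathcal G$ of vectors in $\mathbb R^N$: draw fresh i.i.d. uniform $i_1,\dots,i_B\in[N]$ with $B=\lceil 0.5\,\eta^{-2}T^2\ln\frac{2T}{\rho}\rceil$ and return $\frac1B\sum_{v\in\mathcal G}\sum_{k=1}^B q(i_k)v(i_k)$. Mechanism $\mathcal M_{\mathrm{AQA\text{-}OGD}}$ with parameters $\epsilon,\delta,\lambda$: start with the empty multiset $\mathcal G$. In each round $t$, receive $q_t$ and compute $\hat u_t=\mathrm{IP}_{\mathrm{est}}(q_t,\mathcal G;\lambda\epsilon/8,\delta/(2T))$. If $|\hat u_t-\lambda q_t(S)|>\lambda\epsilon/2$ and $|\mathcal G|\le128(\lambda\epsilon)^{-2}$, then set $s_t=\mathrm{sign}(\hat u_t-\lambda q_t(S))$, add the vector $-\lambda\epsilon s_tq_t/16$ to $\mathcal G$, and let $a_t$ be $q_t(S)$ rounded to the nearest multiple of $\epsilon/2$. Otherwise let $a_t=\hat u_t/\lambda$. Send $a_t$ to $\mathcal A$.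
   Formalization: The formal theorem additionally assumes ε ≤ T or ε ≥ 2, excluding only T = 1 with 1 < ε < 2, where log(T/ε) < 0 can make the sample bound negative and the claim false (e.g. N = 32, λ = 1, ε = 1.5, δ = 0.05, M = 1). *)

theory Defs
  imports "HOL-Probability.Probability"
begin

type_synonym query = "nat \<Rightarrow> real"

text \<open>Histories list the rounds in chronological order: round \<open>t\<close> (counted from 1) sits at index \<open>t - 1\<close>.\<close>
type_synonym history = "(query \<times> real) list"

definition queries :: "nat \<Rightarrow> query set" where
  "queries N = {1..N} \<rightarrow>\<^sub>E {-1, 1}"

definition dist_mean :: "nat pmf \<Rightarrow> query \<Rightarrow> real" where
  "dist_mean D q = measure_pmf.expectation D q"

definition sample_mean :: "nat multiset \<Rightarrow> query \<Rightarrow> real" where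
  "sample_mean S q = (\<Sum>i\<in>#S. q i) / real (size S)"

definition sign_pm :: "real \<Rightarrow> real" where
  "sign_pm x = (if x \<ge> 0 then 1 else -1)"


text \<open>
  All internal randomness of the analyst is a single point of the probability space
  \<open>coins\<close>, which need not be discrete. It determines the distribution and, together
  with the history so far, each query. So the distribution and all queries may be correlated.
\<close>
record 'w analyst =
  coins :: "'w measure"
  target :: "'w \<Rightarrow> nat pmf"
  ask :: "'w \<Rightarrow> history \<Rightarrow> query"

definition inputs :: "nat \<Rightarrow> nat \<Rightarrow> history set" where
  "inputs N T = {h. length h < T \<and> (\<forall>(q, a) \<in> set h. q \<in> queries N)}"

text \<open>
  Measurability of \<open>ask\<close> is only required for each fixed input; this suffices for
  mechanisms whose answers range over a countable set.
\<close>
definition is_analyst :: "nat \<Rightarrow> nat \<Rightarrow> 'w analyst \<Rightarrow> bool" where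
  "is_analyst N T A \<longleftrightarrow>
     prob_space (coins A) \<and>
     (\<forall>w \<in> space (coins A). set_pmf (target A w) \<subseteq> {1..N}) \<and>
     (\<forall>i. (\<lambda>w. pmf (target A w) i) \<in> borel_measurable (coins A)) \<and>
     (\<forall>h \<in> inputs N T. (\<lambda>w. ask A w h) \<in> measurable (coins A) (count_space (queries N)))"

definition possible_queries :: "nat \<Rightarrow> nat \<Rightarrow> 'w analyst \<Rightarrow> query set" where
  "possible_queries N T A = {ask A w h | w h. w \<in> space (coins A) \<and> h \<in> inputs N T}"


definition dense :: "nat \<Rightarrow> real \<Rightarrow> nat pmf \<Rightarrow> bool" where
  "dense N l D \<longleftrightarrow> set_pmf D \<subseteq> {1..N} \<and> (\<forall>i \<in> {1..N}. pmf D i \<le> 1 / (l * real N))"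

definition pseudodense :: "nat \<Rightarrow> nat \<Rightarrow> real \<Rightarrow> real \<Rightarrow> 'w analyst \<Rightarrow> nat pmf \<Rightarrow> bool" where
  "pseudodense N T e l A D \<longleftrightarrow>
     (\<exists>D'. dense N l D' \<and> (\<forall>q \<in> possible_queries N T A. \<bar>dist_mean D q - dist_mean D' q\<bar> \<le> e))"

definition pseudodense_challenger :: "nat \<Rightarrow> nat \<Rightarrow> real \<Rightarrow> real \<Rightarrow> 'w analyst \<Rightarrow> bool" where
  "pseudodense_challenger N T e l A \<longleftrightarrow> (AE w in coins A. pseudodense N T e l A (target A w))"


record 's mechanism =
  start :: "nat multiset \<Rightarrow> 's"
  answer :: "'s \<Rightarrow> query \<Rightarrow> (real \<times> 's) pmf"

primrec play :: "'s mechanism \<Rightarrow> (history \<Rightarrow> query) \<Rightarrow> nat \<Rightarrow> 's \<Rightarrow> history \<Rightarrow> history pmf" where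
  "play m f 0 s h = return_pmf h"
| "play m f (Suc k) s h =
     do { (a, s') \<leftarrow> answer m s (f h);
          play m f k s' (h @ [(f h, a)]) }"

definition transcript ::
  "nat \<Rightarrow> nat \<Rightarrow> 's mechanism \<Rightarrow> nat pmf \<Rightarrow> (history \<Rightarrow> query) \<Rightarrow> history pmf" where
  "transcript T M m D f =
     do { xs \<leftarrow> replicate_pmf M D;
          play m f T (start m (mset xs)) [] }"

text \<open>Joint law of the analyst's internal randomness and the \<open>T\<close>-round history.\<close>
definition game :: "nat \<Rightarrow> nat \<Rightarrow> 's mechanism \<Rightarrow> 'w analyst \<Rightarrow> ('w \<times> history) measure" where
  "game T M m A =
     coins A \<bind> (\<lambda>w. distr (measure_pmf (transcript T M m (target A w) (ask A w)))
                          (coins A \<Otimes>\<^sub>M count_space UNIV) (Pair w))"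

definition accurate ::
  "nat \<Rightarrow> nat \<Rightarrow> real \<Rightarrow> real \<Rightarrow> 's mechanism \<Rightarrow> 'w analyst \<Rightarrow> bool" where
  "accurate T M e d m A \<longleftrightarrow>
     \<P>(x in game T M m A. case x of (w, h) \<Rightarrow>
        \<forall>t<T. \<bar>snd (h ! t) - dist_mean (target A w) (fst (h ! t))\<bar> \<le> e) \<ge> 1 - d"


definition ip_batch :: "nat \<Rightarrow> real \<Rightarrow> real \<Rightarrow> nat" where
  "ip_batch T eta rho = nat \<lceil>0.5 * (1 / eta\<^sup>2) * (real T)\<^sup>2 * ln (2 * real T / rho)\<rceil>"

definition ip_est ::
  "nat \<Rightarrow> nat \<Rightarrow> query \<Rightarrow> (nat \<Rightarrow> real) multiset \<Rightarrow> real \<Rightarrow> real \<Rightarrow> real pmf" where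
  "ip_est N T q G eta rho =
     (let B = ip_batch T eta rho in
      map_pmf (\<lambda>is. 1 / real B * (\<Sum>v\<in>#G. \<Sum>k<B. q (is ! k) * v (is ! k)))
        (replicate_pmf B (pmf_of_set {1..N})))"

text \<open>Ties are rounded up.\<close>
definition round_to :: "real \<Rightarrow> real \<Rightarrow> real" where
  "round_to g x = g * of_int (round (x / g))"

text \<open>The state consists of the sample and the multiset of update vectors.\<close>
definition aqa_ogd ::
  "nat \<Rightarrow> nat \<Rightarrow> real \<Rightarrow> real \<Rightarrow> real \<Rightarrow> (nat multiset \<times> (nat \<Rightarrow> real) multiset) mechanism" where
  "aqa_ogd N T e d l =
     \<lparr> start = (\<lambda>S. (S, {#})),
       answer = (\<lambda>(S, G) q.
         map_pmf
           (\<lambda>u. if \<bar>u - l * sample_mean S q\<bar> > l * e / 2 \<and> real (size G) \<le> 128 * (1 / (l * e)\<^sup>2)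
                then let s = sign_pm (u - l * sample_mean S q)
                     in (round_to (e / 2) (sample_mean S q),
                         (S, add_mset (\<lambda>i. - (l * e * s * q i / 16)) G))
                else (u / l, (S, G)))
           (ip_est N T q G (l * e / 8) (d / (2 * real T)))) \<rparr>"

end

theory Submission
  imports Defs
begin

text \<open>
  The sample influences the transcript only through the update rounds and the rounded answers
  given there. Conditionally on the estimation noise, the transcripts therefore form a tree in
  which each round has one branch without update and at most \<open>4 / \<epsilon> + 2\<close> branches with update, and
  a union bound over this tree, with Hoeffding's inequality at each node, controls
  \<open>q(S) - q(D)\<close> for all queries at once. If
  \<open>\<epsilon> \<ge> 2\<close> there is never an update and all answers are \<open>0\<close>, so let \<open>\<epsilon> < 2\<close> and put \<open>X = 1 / (\<lambda>\<epsilon>)\<^sup>2\<close>.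

  If \<open>T \<le> 128 X + 1\<close>, the cap on the number of updates never takes effect, so sample accuracy
  \<open>\<epsilon> / 2\<close> suffices and the full tree is affordable.

  Otherwise sample accuracy \<open>\<epsilon> / 4\<close> is used. The batch size in fact guarantees estimation error
  \<open>\<lambda>\<epsilon> / 32\<close>, so every update moves the sum of the update vectors closer to the density
  \<open>\<lambda>N D'\<close> of the dense model \<open>D'\<close>: the normalised squared distance, initially at most \<open>1\<close>, drops
  by \<open>(\<lambda>\<epsilon>)\<^sup>2 / 64\<close>. Hence there are at most \<open>64 X\<close> updates, and only this part of the tree counts.
\<close>

subsection \<open>Measurability of the game\<close>

lemma pmf_replicate_pmf:
  "pmf (replicate_pmf n D) xs = (if length xs = n then prod_list (map (pmf D) xs) else 0)"
proof (induction n arbitrary: xs)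
  case 0
  then show ?case by (auto simp: pmf_return)
next
  case (Suc n)
  have *: "replicate_pmf (Suc n) D = map_pmf (\<lambda>(x, xs). x # xs) (pair_pmf D (replicate_pmf n D))"
    by (simp add: pair_pmf_def map_bind_pmf)
  show ?case
  proof (cases xs)
    case Nil
    then show ?thesis
      unfolding * by (auto simp: pmf_eq_0_set_pmf)
  next
    case (Cons y ys)
    have "pmf (map_pmf (\<lambda>(x, xs). x # xs) (pair_pmf D (replicate_pmf n D))) ((\<lambda>(x, xs). x # xs) (y, ys))
        = pmf (pair_pmf D (replicate_pmf n D)) (y, ys)"
      by (rule pmf_map_inj') (auto simp: inj_on_def)
    then show ?thesis
      unfolding * by (simp add: Cons pmf_pair Suc.IH)
  qed
qed

lemma finite_queries: "finite (queries N)"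
  by (auto simp: queries_def intro: finite_PiE)

lemma finite_lists_of_length: "finite A \<Longrightarrow> finite {xs \<in> lists A. length xs = n}"
  using finite_lists_length_eq[of A n] by (simp add: lists_eq_set)

text \<open>Induction on the remaining rounds. A round admits finitely many queries and answers, so
  the integral over an answer is a finite sum, and \<open>ask\<close> is evaluated only at fixed
  histories, where it is measurable by assumption.\<close>

lemma play_emeasure_measurable:
  assumes A: "is_analyst N T A"
    and fin: "\<And>s q. finite (set_pmf (answer m s q))"
    and "length h + k \<le> T" and "\<forall>(q, a) \<in> set h. q \<in> queries N"
  shows "(\<lambda>w. emeasure (measure_pmf (play m (ask A w) k s h)) X) \<in> borel_measurable (coins A)"
  using assms(3,4)
proof (induction k arbitrary: s h)
  case 0
  then show ?case by simp
next
  case (Suc k)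
  then have "h \<in> inputs N T"
    by (auto simp: inputs_def)
  with A have ask: "(\<lambda>w. ask A w h) \<in> measurable (coins A) (count_space (queries N))"
    by (auto simp: is_analyst_def)
  have "(\<lambda>w. \<integral>\<^sup>+x. emeasure (measure_pmf (play m (ask A w) k (snd x) (h @ [(q, fst x)]))) X
           \<partial>measure_pmf (answer m s q)) \<in> borel_measurable (coins A)" if "q \<in> queries N" for q
    unfolding nn_integral_measure_pmf_finite[OF fin zero_le]
    using Suc.prems that
    by (intro borel_measurable_sum borel_measurable_times_ennreal borel_measurable_const Suc.IH) auto
  \<comment> \<open>The query depends on the coins but takes finitely many values, so measurability
    for each fixed query suffices.\<close>
  from measurable_compose_countable'[OF this ask]
  show ?case
    by (simp add: case_prod_unfold finite_queries countable_finite)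
qed

text \<open>The sample ranges over a finite set of lists, and the probability of each list is a
  product of weights \<open>pmf (target A w) i\<close>, which are measurable in
  \<open>w\<close>.\<close>

lemma transcript_emeasure_measurable:
  assumes A: "is_analyst N T A"
    and fin: "\<And>s q. finite (set_pmf (answer m s q))"
  shows "(\<lambda>w. emeasure (measure_pmf (transcript T M m (target A w) (ask A w))) X)
    \<in> borel_measurable (coins A)"
proof -
  define L where "L = {xs \<in> lists {1..N}. length xs = M}"
  have "finite L"
    by (simp add: L_def finite_lists_of_length)
  have "emeasure (measure_pmf (transcript T M m (target A w) (ask A w))) X =
      (\<Sum>xs\<in>L. emeasure (measure_pmf (play m (ask A w) T (start m (mset xs)) [])) X
         * ennreal (prod_list (map (pmf (target A w)) xs)))"
    if "w \<in> space (coins A)" for w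
  proof -
    have "set_pmf (target A w) \<subseteq> {1..N}"
      using A that by (auto simp: is_analyst_def)
    then have "set_pmf (replicate_pmf M (target A w)) \<subseteq> L"
      by (auto simp: set_replicate_pmf L_def)
    then show ?thesis
      using \<open>finite L\<close> unfolding transcript_def emeasure_bind_pmf
      by (subst nn_integral_measure_pmf_support[of L])
        (auto simp: pmf_replicate_pmf L_def pmf_eq_0_set_pmf intro!: sum.cong)
  qed
  moreover have "(\<lambda>w. prod_list (map (pmf (target A w)) xs)) \<in> borel_measurable (coins A)" for xs
    using A by (induction xs) (auto simp: is_analyst_def intro!: borel_measurable_times)
  then have "(\<lambda>w. \<Sum>xs\<in>L. emeasure (measure_pmf (play m (ask A w) T (start m (mset xs)) [])) X
         * ennreal (prod_list (map (pmf (target A w)) xs))) \<in> borel_measurable (coins A)"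
    by (intro borel_measurable_sum borel_measurable_times_ennreal play_emeasure_measurable[OF A fin]
        measurable_compose[OF _ measurable_ennreal]) auto
  ultimately show ?thesis
    by (simp cong: measurable_cong)
qed

lemma dist_mean_eq_sum:
  assumes "set_pmf D \<subseteq> {1..N}"
  shows "dist_mean D q = (\<Sum>i\<in>{1..N}. pmf D i * q i)"
  unfolding dist_mean_def using assms
  by (subst integral_measure_pmf[of "{1..N}"]) auto

text \<open>Conditioning on the coins: the transcript is a probability kernel in \<open>w\<close>,
  so a bound for almost every fixed \<open>w\<close> integrates to a bound for the game.\<close>

lemma accurateI:
  assumes A: "is_analyst N T A"
    and fin: "\<And>s q. finite (set_pmf (answer m s q))"
    and good: "AE w in coins A. measure_pmf.prob (transcript T M m (target A w) (ask A w))
       {h. \<forall>t<T. \<bar>snd (h ! t) - dist_mean (target A w) (fst (h ! t))\<bar> \<le> e} \<ge> 1 - d"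
  shows "accurate T M e d m A"
proof -
  interpret C: prob_space "coins A"
    using A by (simp add: is_analyst_def)
  let ?S = "coins A \<Otimes>\<^sub>M count_space UNIV :: ('a \<times> history) measure"
  let ?tr = "\<lambda>w. transcript T M m (target A w) (ask A w)"
  let ?K = "\<lambda>w. distr (measure_pmf (?tr w)) ?S (Pair w)"
  let ?E = "{x \<in> space ?S. \<forall>t<T. \<bar>snd (snd x ! t) - dist_mean (target A (fst x)) (fst (snd x ! t))\<bar> \<le> e}"
  have tr: "(\<lambda>w. measure_pmf (?tr w)) \<in> measurable (coins A) (subprob_algebra (count_space UNIV))"
    using transcript_emeasure_measurable[OF A fin]
    by (intro measurable_subprob_algebra)
      (auto intro: prob_space_imp_subprob_space measure_pmf.prob_space_axioms)
  have K: "?K \<in> measurable (coins A) (subprob_algebra ?S)"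
    by (rule measurable_distr2[OF _ tr]) simp
  have "prob_space (?K w)" if "w \<in> space (coins A)" for w
    using that by (intro measure_pmf.prob_space_distr) (auto simp: space_pair_measure)
  then interpret G: prob_space "game T M m A"
    unfolding game_def by (intro C.prob_space_bind[OF _ K]) auto
  have sets: "sets (game T M m A) = sets ?S"
    unfolding game_def by (rule sets_bind) (simp_all only: sets_distr C.not_empty simp_thms not_False_eq_True)
  then have space: "space (game T M m A) = space ?S"
    by (rule sets_eq_imp_space_eq)
  have mean: "dist_mean (target A (fst x)) q = (\<Sum>i\<in>{1..N}. pmf (target A (fst x)) i * q i)"
    if "x \<in> space ?S" for x q
    using A that by (intro dist_mean_eq_sum) (auto simp: is_analyst_def space_pair_measure)
  \<comment> \<open>As a finite sum of point weights the mean is measurable in the coins, and hence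
    so is the accuracy event.\<close>
  have "?E = {x \<in> space ?S. \<forall>t\<in>{..<T}. \<bar>snd (snd x ! t) -
      (\<Sum>i\<in>{1..N}. pmf (target A (fst x)) i * fst (snd x ! t) i)\<bar> \<le> e}"
    by (intro Collect_cong conj_cong refl) (simp add: mean Ball_def)
  also have "\<dots> \<in> sets ?S"
  proof -
    have [measurable]: "(\<lambda>w. pmf (target A w) i) \<in> borel_measurable (coins A)" for i
      using A by (auto simp: is_analyst_def)
    have [measurable]: "(\<lambda>x. snd (snd x ! t)) \<in> borel_measurable ?S"
      "(\<lambda>x. fst (snd x ! t) i) \<in> borel_measurable ?S" for t i
      by (rule measurable_compose[OF measurable_snd], simp)+
    have [measurable]: "(\<lambda>x. \<bar>snd (snd x ! t) -
        (\<Sum>i\<in>{1..N}. pmf (target A (fst x)) i * fst (snd x ! t) i)\<bar>) \<in> borel_measurable ?S" for t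
      by measurable
    show ?thesis
      by (intro sets.sets_Collect_finite_All borel_measurable_le) auto
  qed
  finally have E: "?E \<in> sets ?S" .
  have "ennreal (1 - d) = (\<integral>\<^sup>+w. ennreal (1 - d) \<partial>coins A)"
    by (simp add: C.emeasure_space_1)
  also have "\<dots> \<le> (\<integral>\<^sup>+w. emeasure (?K w) ?E \<partial>coins A)"
  proof (rule nn_integral_mono_AE, use good AE_space in eventually_elim)
    fix w assume w: "w \<in> space (coins A)" and
      p: "measure_pmf.prob (?tr w)
       {h. \<forall>t<T. \<bar>snd (h ! t) - dist_mean (target A w) (fst (h ! t))\<bar> \<le> e} \<ge> 1 - d"
    have *: "Pair w -` ?E = {h. \<forall>t<T. \<bar>snd (h ! t) - dist_mean (target A w) (fst (h ! t))\<bar> \<le> e}"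
      using w by (auto simp: space_pair_measure)
    have "Pair w \<in> measurable (measure_pmf (?tr w)) ?S"
      using w by (auto simp: space_pair_measure)
    then have "emeasure (?K w) ?E = emeasure (measure_pmf (?tr w))
        {h. \<forall>t<T. \<bar>snd (h ! t) - dist_mean (target A w) (fst (h ! t))\<bar> \<le> e}"
      by (simp only: emeasure_distr[OF _ E] * space_measure_pmf Int_UNIV_right)
    with p show "ennreal (1 - d) \<le> emeasure (?K w) ?E"
      by (simp add: measure_pmf.emeasure_eq_measure)
  qed
  also have "\<dots> = emeasure (game T M m A) ?E"
    unfolding game_def by (rule emeasure_bind[OF C.not_empty K E, symmetric])
  finally have "1 - d \<le> measure (game T M m A) ?E"
    by (simp add: G.emeasure_eq_measure)
  then show ?thesis
    by (simp add: accurate_def space case_prod_unfold)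
qed

subsection \<open>Concentration\<close>

text \<open>Independence of the draws in the form needed for Chernoff's bound: the moment generating
  function factorises.\<close>

lemma nn_integral_exp_sum_replicate_pmf:
  fixes g :: "'a \<Rightarrow> real"
  shows "(\<integral>\<^sup>+xs. ennreal (exp (s * (\<Sum>x\<leftarrow>xs. g x))) \<partial>measure_pmf (replicate_pmf n D))
    = (\<integral>\<^sup>+x. ennreal (exp (s * g x)) \<partial>measure_pmf D) ^ n"
proof (induction n)
  case (Suc n)
  then show ?case
    by (simp add: distrib_left exp_add ennreal_mult nn_integral_cmult nn_integral_multc)
qed simp

lemma replicate_pmf_Hoeffding_ge:
  fixes f :: "'a \<Rightarrow> real"
  assumes "\<And>x. x \<in> set_pmf D \<Longrightarrow> f x \<in> {a..b}" and "a < b" "n > 0" "t > 0"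
  shows "emeasure (measure_pmf (replicate_pmf n D))
      {xs. (\<Sum>x\<leftarrow>xs. f x - measure_pmf.expectation D f) \<ge> t}
    \<le> ennreal (exp (- 2 * t\<^sup>2 / (real n * (b - a)\<^sup>2)))"
proof -
  \<comment> \<open>The minimiser of \<open>n * s\<^sup>2 * (b - a)\<^sup>2 / 8 - s * t\<close>, the
    exponent left by Chernoff's inequality and Hoeffding's lemma.\<close>
  define s where "s = 4 * t / (real n * (b - a)\<^sup>2)"
  have s: "s > 0"
    using assms by (auto simp: s_def intro!: divide_pos_pos mult_pos_pos)
  interpret interval_bounded_random_variable "measure_pmf D" f a b
    using assms(1) by unfold_locales (auto simp: AE_measure_pmf_iff)
  let ?\<mu> = "measure_pmf.expectation D f"
  have "emeasure (measure_pmf (replicate_pmf n D)) {xs \<in> UNIV. (\<Sum>x\<leftarrow>xs. f x - ?\<mu>) \<ge> t}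
      \<le> ennreal (exp (- s * t)) * (\<integral>\<^sup>+xs. ennreal (exp (s * (\<Sum>x\<leftarrow>xs. f x - ?\<mu>))) * indicator UNIV xs
           \<partial>measure_pmf (replicate_pmf n D))"
    by (rule Chernoff_ineq_nn_integral_ge[OF s]) auto
  also have "\<dots> = ennreal (exp (- s * t)) * (\<integral>\<^sup>+x. ennreal (exp (s * (f x - ?\<mu>))) \<partial>measure_pmf D) ^ n"
    by (simp add: nn_integral_exp_sum_replicate_pmf)
  also have "\<dots> \<le> ennreal (exp (- s * t)) * ennreal (exp (s\<^sup>2 * (b - a)\<^sup>2 / 8)) ^ n"
    by (intro mult_left_mono power_mono Hoeffdings_lemma_nn_integral s) auto
  also have "\<dots> = ennreal (exp (real n * (s\<^sup>2 * (b - a)\<^sup>2 / 8) - s * t))"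
    by (simp add: ennreal_power exp_of_nat_mult[symmetric] flip: ennreal_mult exp_add)
  also have "real n * (s\<^sup>2 * (b - a)\<^sup>2 / 8) - s * t = - 2 * t\<^sup>2 / (real n * (b - a)\<^sup>2)"
  proof -
    have "real n * ((4 * t / (real n * w))\<^sup>2 * w / 8) - 4 * t / (real n * w) * t = - 2 * t\<^sup>2 / (real n * w)"
      if "w > 0" for w
      using that \<open>n > 0\<close> by (simp add: field_simps power2_eq_square)
    from this[of "(b - a)\<^sup>2"] show ?thesis
      using \<open>a < b\<close> by (simp add: s_def)
  qed
  finally show ?thesis by simp
qed

lemma replicate_pmf_Hoeffding_abs_ge:
  fixes f :: "'a \<Rightarrow> real"
  assumes "\<And>x. x \<in> set_pmf D \<Longrightarrow> f x \<in> {a..b}" and "a < b" "n > 0" "t > 0"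
  shows "emeasure (measure_pmf (replicate_pmf n D))
      {xs. \<bar>(\<Sum>x\<leftarrow>xs. f x) / real n - measure_pmf.expectation D f\<bar> \<ge> t}
    \<le> ennreal (2 * exp (- 2 * real n * t\<^sup>2 / (b - a)\<^sup>2))"
proof -
  let ?\<mu> = "measure_pmf.expectation D f" and ?P = "measure_pmf (replicate_pmf n D)"
  let ?U = "{xs. (\<Sum>x\<leftarrow>xs. f x - ?\<mu>) \<ge> real n * t}"
  let ?L = "{xs. (\<Sum>x\<leftarrow>xs. - f x - measure_pmf.expectation D (\<lambda>x. - f x)) \<ge> real n * t}"
  have "- 2 * (real n * t)\<^sup>2 / (real n * w) = - 2 * real n * t\<^sup>2 / w" for w
    using \<open>n > 0\<close> by (simp add: power2_eq_square)
  then have "emeasure ?P ?U \<le> ennreal (exp (- 2 * real n * t\<^sup>2 / (b - a)\<^sup>2))"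
    "emeasure ?P ?L \<le> ennreal (exp (- 2 * real n * t\<^sup>2 / (b - a)\<^sup>2))"
    using replicate_pmf_Hoeffding_ge[of D f a b n "real n * t"]
      replicate_pmf_Hoeffding_ge[of D "\<lambda>x. - f x" "- b" "- a" n "real n * t"] assms
    by auto
  moreover have "emeasure ?P {xs. \<bar>(\<Sum>x\<leftarrow>xs. f x) / real n - ?\<mu>\<bar> \<ge> t} \<le> emeasure ?P (?U \<union> ?L)"
  proof (rule emeasure_mono_AE)
    have "xs \<in> ?U \<union> ?L" if "xs \<in> set_pmf (replicate_pmf n D)"
      and "t \<le> \<bar>(\<Sum>x\<leftarrow>xs. f x) / real n - ?\<mu>\<bar>" for xs
    proof -
      have "length xs = n"
        using that by (simp add: set_replicate_pmf)
      then have "(\<Sum>x\<leftarrow>xs. f x - ?\<mu>) = real n * ((\<Sum>x\<leftarrow>xs. f x) / real n - ?\<mu>)"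
        "(\<Sum>x\<leftarrow>xs. - f x - measure_pmf.expectation D (\<lambda>x. - f x))
          = - (real n * ((\<Sum>x\<leftarrow>xs. f x) / real n - ?\<mu>))"
        using \<open>n > 0\<close> by (simp_all add: sum_list_subtractf sum_list_triv right_diff_distrib
            uminus_sum_list_map[unfolded o_def, symmetric])
      with that(2) \<open>n > 0\<close> show ?thesis
        by (auto simp: abs_if minus_mult_right split: if_splits)
    qed
    then show "AE xs in ?P. xs \<in> {xs. \<bar>(\<Sum>x\<leftarrow>xs. f x) / real n - ?\<mu>\<bar> \<ge> t} \<longrightarrow> xs \<in> ?U \<union> ?L"
      by (auto simp: AE_measure_pmf_iff)
  qed auto
  moreover have "emeasure ?P (?U \<union> ?L) \<le> emeasure ?P ?U + emeasure ?P ?L"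
    by (rule emeasure_subadditive) auto
  ultimately have "emeasure ?P {xs. \<bar>(\<Sum>x\<leftarrow>xs. f x) / real n - ?\<mu>\<bar> \<ge> t}
    \<le> ennreal (exp (- 2 * real n * t\<^sup>2 / (b - a)\<^sup>2)) + ennreal (exp (- 2 * real n * t\<^sup>2 / (b - a)\<^sup>2))"
    by (meson add_mono order_trans)
  then show ?thesis
    by (simp flip: ennreal_plus)
qed

lemma queriesD:
  assumes "q \<in> queries N"
  shows "i \<in> {1..N} \<Longrightarrow> \<bar>q i\<bar> = 1" "i \<in> {1..N} \<Longrightarrow> q i * q i = 1"
  using PiE_mem[OF assms[unfolded queries_def], of i] by auto

text \<open>Hoeffding's inequality on an interval of length \<open>2\<close>, for a query fixed
  before the sample is drawn; adaptivity is handled by the union bound.\<close>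

lemma sample_mean_tail:
  assumes D: "set_pmf D \<subseteq> {1..N}" and q: "q \<in> queries N" and "M > 0" "t > 0"
  shows "emeasure (measure_pmf (replicate_pmf M D)) {xs. \<not> \<bar>sample_mean (mset xs) q - dist_mean D q\<bar> \<le> t}
     \<le> ennreal (2 * exp (- real M * t\<^sup>2 / 2))"
proof -
  have "q x \<in> {-1..1}" if "x \<in> set_pmf D" for x
    using queriesD(1)[OF q, of x] that D by auto
  from replicate_pmf_Hoeffding_abs_ge[of D q, OF this _ \<open>M > 0\<close> \<open>t > 0\<close>]
  have "emeasure (measure_pmf (replicate_pmf M D)) {xs. \<bar>(\<Sum>x\<leftarrow>xs. q x) / real M - dist_mean D q\<bar> \<ge> t}
     \<le> ennreal (2 * exp (- real M * t\<^sup>2 / 2))"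
    by (simp add: dist_mean_def)
  moreover have "emeasure (measure_pmf (replicate_pmf M D)) {xs. \<not> \<bar>sample_mean (mset xs) q - dist_mean D q\<bar> \<le> t}
    \<le> emeasure (measure_pmf (replicate_pmf M D)) {xs. \<bar>(\<Sum>x\<leftarrow>xs. q x) / real M - dist_mean D q\<bar> \<ge> t}"
    by (rule emeasure_mono_AE)
      (auto simp: AE_measure_pmf_iff set_replicate_pmf sample_mean_def sum_mset_sum_list
        simp flip: mset_map)
  ultimately show ?thesis by simp
qed

section \<open>The inner-product estimator as an empirical mean\<close>

definition gvec :: "(nat \<Rightarrow> real) multiset \<Rightarrow> nat \<Rightarrow> real" where
  "gvec G i = (\<Sum>v\<in>#G. v i)"

definition inner_mean :: "nat \<Rightarrow> (nat \<Rightarrow> real) \<Rightarrow> (nat \<Rightarrow> real) \<Rightarrow> real" where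
  "inner_mean N x y = (\<Sum>i\<in>{1..N}. x i * y i) / real N"

lemma abs_gvec_le:
  assumes "\<forall>v\<in>#G. \<bar>v i\<bar> \<le> c"
  shows "\<bar>gvec G i\<bar> \<le> real (size G) * c"
  using assms
proof (induction G)
  case (add v G)
  then have "\<bar>gvec G i\<bar> \<le> real (size G) * c" "\<bar>v i\<bar> \<le> c"
    by auto
  moreover have "gvec (add_mset v G) i = v i + gvec G i"
    by (simp add: gvec_def)
  ultimately show ?case
    by (simp add: algebra_simps)
qed (simp add: gvec_def)

text \<open>Exchanging the two sums leaves the empirical mean of the single function
  \<open>q x * gvec G x\<close>, to which Hoeffding's inequality applies.\<close>

lemma ip_est_eq:
  "ip_est N T q G \<eta> \<rho> = map_pmf (\<lambda>xs. (\<Sum>x\<leftarrow>xs. q x * gvec G x) / real (ip_batch T \<eta> \<rho>))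
    (replicate_pmf (ip_batch T \<eta> \<rho>) (pmf_of_set {1..N}))"
proof -
  have "(\<Sum>v\<in>#G. \<Sum>k<length xs. q (xs ! k) * v (xs ! k)) = (\<Sum>x\<leftarrow>xs. q x * gvec G x)" for xs
  proof (induction G)
    case (add v G)
    then show ?case
      by (simp add: gvec_def sum_list_sum_nth atLeast0LessThan distrib_left sum.distrib)
  qed (simp add: gvec_def)
  note eq = this
  show ?thesis
    unfolding ip_est_def Let_def
  proof (intro map_pmf_cong refl)
    fix xs :: "nat list" assume "xs \<in> set_pmf (replicate_pmf (ip_batch T \<eta> \<rho>) (pmf_of_set {1..N}))"
    then have len: "ip_batch T \<eta> \<rho> = length xs"
      by (simp add: set_replicate_pmf)
    show "1 / real (ip_batch T \<eta> \<rho>) * (\<Sum>v\<in>#G. \<Sum>k<ip_batch T \<eta> \<rho>. q (xs ! k) * v (xs ! k))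
        = (\<Sum>x\<leftarrow>xs. q x * gvec G x) / real (ip_batch T \<eta> \<rho>)"
      unfolding len eq by simp
  qed
qed

text \<open>A sum of at most \<open>T\<close> vectors with entries bounded by \<open>c\<close> has
  entries bounded by \<open>T * c\<close>, so the interval in Hoeffding's inequality has length
  \<open>2 * T * c\<close>.\<close>

lemma ip_est_tail:
  assumes "N > 0" and q: "q \<in> queries N" and "c > 0" and "t > 0"
    and G: "\<forall>v\<in>#G. \<forall>i\<in>{1..N}. \<bar>v i\<bar> \<le> c" "size G \<le> T" "T > 0"
    and B: "ip_batch T \<eta> \<rho> > 0"
  shows "emeasure (measure_pmf (ip_est N T q G \<eta> \<rho>)) {u. \<not> \<bar>u - inner_mean N q (gvec G)\<bar> \<le> t}
    \<le> ennreal (2 * exp (- real (ip_batch T \<eta> \<rho>) * t\<^sup>2 / (2 * (real T * c)\<^sup>2)))"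
proof -
  let ?D = "pmf_of_set {1..N}" and ?B = "ip_batch T \<eta> \<rho>" and ?f = "\<lambda>x. q x * gvec G x"
  have set: "set_pmf ?D = {1..N}"
    using \<open>N > 0\<close> by (intro set_pmf_of_set) auto
  have expo: "- 2 * real ?B * t\<^sup>2 / (x - - x)\<^sup>2 = - real ?B * t\<^sup>2 / (2 * x\<^sup>2)" for x
    by (cases "x = 0") (simp_all add: field_simps power2_eq_square)
  have mean: "measure_pmf.expectation ?D ?f = inner_mean N q (gvec G)"
    unfolding inner_mean_def using \<open>N > 0\<close> by (subst integral_pmf_of_set) auto
  have *: "\<bar>q x * gvec G x\<bar> \<le> real T * c" if "x \<in> {1..N}" for x
  proof -
    have "\<bar>gvec G x\<bar> \<le> real (size G) * c"
      using G that by (intro abs_gvec_le) auto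
    also have "\<dots> \<le> real T * c"
      using G \<open>c > 0\<close> by (intro mult_right_mono) auto
    finally show ?thesis
      using queriesD(1)[OF q that] by (simp add: abs_mult)
  qed
  have "?f x \<in> {- (real T * c)..real T * c}" if "x \<in> set_pmf ?D" for x
    using *[of x] that unfolding set by (auto simp: abs_le_iff)
  from replicate_pmf_Hoeffding_abs_ge[of ?D ?f, OF this _ B \<open>t > 0\<close>]
  have "emeasure (measure_pmf (replicate_pmf ?B ?D))
      {xs. \<bar>(\<Sum>x\<leftarrow>xs. ?f x) / real ?B - inner_mean N q (gvec G)\<bar> \<ge> t}
    \<le> ennreal (2 * exp (- real ?B * t\<^sup>2 / (2 * (real T * c)\<^sup>2)))"
    unfolding mean expo using \<open>c > 0\<close> \<open>T > 0\<close> by simp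
  moreover have "emeasure (measure_pmf (ip_est N T q G \<eta> \<rho>)) {u. \<not> \<bar>u - inner_mean N q (gvec G)\<bar> \<le> t}
     \<le> emeasure (measure_pmf (replicate_pmf ?B ?D))
      {xs. \<bar>(\<Sum>x\<leftarrow>xs. ?f x) / real ?B - inner_mean N q (gvec G)\<bar> \<ge> t}"
    unfolding ip_est_eq emeasure_map_pmf by (intro emeasure_mono) auto
  ultimately show ?thesis by simp
qed

subsection \<open>Union bound over transcripts\<close>

text \<open>Follows from the symmetry of the product distribution. It lets the average over the
  sample move inside the average over the estimation noise.\<close>

lemma nn_integral_measure_pmf_swap:
  fixes F :: "'a \<Rightarrow> 'b \<Rightarrow> ennreal"
  shows "(\<integral>\<^sup>+x. \<integral>\<^sup>+y. F x y \<partial>measure_pmf Q \<partial>measure_pmf P)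
    = (\<integral>\<^sup>+y. \<integral>\<^sup>+x. F x y \<partial>measure_pmf P \<partial>measure_pmf Q)"
proof -
  have "(\<integral>\<^sup>+x. \<integral>\<^sup>+y. F x y \<partial>measure_pmf Q \<partial>measure_pmf P)
      = (\<integral>\<^sup>+z. F (fst z) (snd z) \<partial>measure_pmf (pair_pmf P Q))"
    by (simp add: nn_integral_pair_pmf')
  also have "\<dots> = (\<integral>\<^sup>+z. F (snd z) (fst z) \<partial>measure_pmf (pair_pmf Q P))"
    by (subst pair_commute_pmf) (simp add: case_prod_unfold)
  finally show ?thesis
    by (simp add: nn_integral_pair_pmf')
qed

lemma abs_round_to_diff_le: "g > 0 \<Longrightarrow> \<bar>round_to g x - x\<bar> \<le> g / 2"
proof -
  assume g: "g > 0"
  have "\<bar>round_to g x - x\<bar> = \<bar>g * (of_int (round (x / g)) - x / g)\<bar>"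
    using g by (simp add: round_to_def right_diff_distrib)
  also have "\<dots> = g * \<bar>of_int (round (x / g)) - x / g\<bar>"
    using g by (simp add: abs_mult)
  also have "\<dots> \<le> g * (1 / 2)"
    using g by (intro mult_left_mono of_int_round_abs_le) auto
  finally show ?thesis by simp
qed

lemma abs_sample_mean_le:
  assumes "set_mset S \<subseteq> {1..N}" "q \<in> queries N"
  shows "\<bar>sample_mean S q\<bar> \<le> 1"
proof -
  have "\<bar>\<Sum>i\<in>#S. q i\<bar> \<le> real (size S)"
    using assms(1)
  proof (induction S)
    case (add i S)
    then show ?case
      using queriesD(1)[OF assms(2), of i] by auto
  qed simp
  \<comment> \<open>The empty sample has mean \<open>0\<close>, by division by zero.\<close>
  then show ?thesis
    by (cases "size S = 0") (auto simp: sample_mean_def divide_le_eq)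
qed

lemma set_pmf_play_length: "h' \<in> set_pmf (play m f k s h) \<Longrightarrow> length h' = length h + k"
  by (induction k arbitrary: s h) (fastforce simp: case_prod_unfold)+

text \<open>Number of internal nodes of a transcript tree of depth \<open>j\<close> in which every path has at most
  \<open>k\<close> updates and every update has \<open>R\<close> outcomes.\<close>
primrec branch_count :: "real \<Rightarrow> nat \<Rightarrow> nat \<Rightarrow> real" where
  "branch_count R 0 k = 0"
| "branch_count R (Suc j) k = 1 + branch_count R j k + (if k = 0 then 0 else R * branch_count R j (k - 1))"

lemma branch_count_nonneg: "R \<ge> 0 \<Longrightarrow> branch_count R j k \<ge> 0"
  by (induction j arbitrary: k) auto

text \<open>Whatever the budget, a node has at most \<open>1 + R\<close> children, so the count is
  bounded by a geometric sum; multiplying by \<open>R\<close> avoids the division.\<close>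

lemma branch_count_le_power: "R \<ge> 0 \<Longrightarrow> R * branch_count R j k + 1 \<le> (1 + R) ^ j"
proof (induction j arbitrary: k)
  case (Suc j)
  have "R * branch_count R (Suc j) k + 1 \<le>
      (R * branch_count R j k + 1) + R * (R * branch_count R j (k - 1) + 1)"
    using Suc.prems by (auto simp: algebra_simps branch_count_nonneg)
  also have "\<dots> \<le> (1 + R) ^ j + R * (1 + R) ^ j"
    using Suc by (intro add_mono mult_left_mono) auto
  finally show ?case
    by (simp add: algebra_simps)
qed simp

text \<open>At each of the \<open>j\<close> depths, a node is given by the positions and outcomes of
  at most \<open>k\<close> updates, which leaves at most \<open>(1 + j * R) ^ k\<close>
  choices.\<close>

lemma branch_count_le_budget: "R \<ge> 0 \<Longrightarrow> branch_count R j k \<le> real j * (1 + real j * R) ^ k"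
proof (induction j arbitrary: k)
  case (Suc j)
  define y where "y = 1 + real j * R"
  have y: "y \<ge> 1"
    using Suc.prems by (simp add: y_def)
  have "1 \<le> (y + R) ^ k"
    using y Suc.prems by (intro one_le_power) auto
  moreover have "branch_count R j k + (if k = 0 then 0 else R * branch_count R j (k - 1))
      \<le> real j * (y + R) ^ k"
  proof (cases k)
    case 0
    then show ?thesis
      using Suc.IH[of k] Suc.prems by simp
  next
    case (Suc k')
    have "branch_count R j k + R * branch_count R j k' \<le>
        real j * y ^ k + R * (real j * y ^ k')"
      using Suc.IH Suc.prems by (intro add_mono mult_left_mono) (auto simp: y_def)
    also have "\<dots> = real j * (y ^ k' * (y + R))"
      by (simp add: Suc algebra_simps)
    also have "\<dots> \<le> real j * ((y + R) ^ k' * (y + R))"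
      using y Suc.prems by (intro mult_left_mono mult_right_mono power_mono) auto
    finally show ?thesis
      by (simp add: Suc mult.commute)
  qed
  ultimately have "branch_count R (Suc j) k \<le> real (Suc j) * (y + R) ^ k"
    by (simp add: distrib_right)
  moreover have "1 + real (Suc j) * R = y + R"
    by (simp add: y_def algebra_simps)
  ultimately show ?case
    by (simp only:)
qed simp

text \<open>The analyst's coins are fixed here, so its strategy is a deterministic function
  \<open>f\<close> of the history; the randomness left is that of the sample and of the
  estimates.\<close>

locale aqa_game =
  fixes N T :: nat and e d l :: real and f :: "history \<Rightarrow> query"
  assumes ask_queries: "h \<in> inputs N T \<Longrightarrow> f h \<in> queries N"
    and e_pos: "0 < e" and l_pos: "0 < l"
begin

abbreviation est :: "query \<Rightarrow> (nat \<Rightarrow> real) multiset \<Rightarrow> real pmf" where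
  "est q G \<equiv> ip_est N T q G (l * e / 8) (d / (2 * real T))"

definition update :: "real \<Rightarrow> query \<Rightarrow> nat \<Rightarrow> real" where
  "update z q i = - (l * e * sign_pm z * q i / 16)"

definition levels :: "real set" where
  "levels = round_to (e / 2) ` {-1..1}"

text \<open>
  Expected number of queries from \<open>B\<close> met in \<open>j\<close> further rounds when every outcome of an update is
  followed, whatever the sample says. Only \<open>B\<close> depends on the sample, so averaging over the
  sample commutes with the recursion.
\<close>
primrec miss :: "query set \<Rightarrow> nat \<Rightarrow> nat \<Rightarrow> (nat \<Rightarrow> real) multiset \<Rightarrow> history \<Rightarrow> ennreal" where
  "miss B 0 k G h = 0"
| "miss B (Suc j) k G h = indicator B (f h) +
    (\<integral>\<^sup>+u. miss B j k G (h @ [(f h, u / l)]) + (if k = 0 then 0 else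
       \<Sum>r\<in>levels. miss B j (k - 1) (add_mset (update (u - l * r) (f h)) G) (h @ [(f h, r)]))
     \<partial>measure_pmf (est (f h) G))"

text \<open>The levels are multiples \<open>j * e / 2\<close> with
  \<open>\<bar>j\<bar> \<le> 2 / e + 1 / 2\<close>, because rounding moves
  \<open>x / (e / 2)\<close> by at most \<open>1 / 2\<close>.\<close>

lemma levels_card: "finite levels" "real (card levels) \<le> 4 / e + 2"
proof -
  let ?J = "{- \<lfloor>2 / e + 1 / 2\<rfloor>..\<lfloor>2 / e + 1 / 2\<rfloor>}"
  have sub: "levels \<subseteq> (\<lambda>j. e / 2 * of_int j) ` ?J"
  proof
    fix r assume "r \<in> levels"
    then obtain x where x: "-1 \<le> x" "x \<le> 1" and r: "r = round_to (e / 2) x"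
      by (auto simp: levels_def)
    let ?j = "round (x / (e / 2))"
    have "x / (e / 2) \<le> 2 / e" "- (2 / e) \<le> x / (e / 2)"
      using x e_pos by (auto simp: field_simps)
    moreover have "\<bar>real_of_int ?j - x / (e / 2)\<bar> \<le> 1 / 2"
      by (rule of_int_round_abs_le)
    ultimately have "real_of_int ?j \<le> 2 / e + 1 / 2" "real_of_int (- ?j) \<le> 2 / e + 1 / 2"
      unfolding of_int_minus by linarith+
    then have "?j \<le> \<lfloor>2 / e + 1 / 2\<rfloor>" "- ?j \<le> \<lfloor>2 / e + 1 / 2\<rfloor>"
      by (simp_all only: le_floor_iff)
    then have "?j \<in> ?J"
      by auto
    then show "r \<in> (\<lambda>j. e / 2 * of_int j) ` ?J"
      using r by (auto simp: round_to_def)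
  qed
  then show "finite levels"
    by (rule finite_subset) auto
  have "card levels \<le> card ?J"
    using card_mono[OF _ sub] card_image_le[of ?J "\<lambda>j. e / 2 * of_int j"] by simp
  moreover have "real (card ?J) = 2 * of_int \<lfloor>2 / e + 1 / 2\<rfloor> + 1"
    using e_pos by (simp add: of_nat_nat)
  moreover have "of_int \<lfloor>2 / e + 1 / 2\<rfloor> \<le> 2 / e + 1 / 2"
    by (rule of_int_floor_le)
  ultimately show "real (card levels) \<le> 4 / e + 2"
    by linarith
qed

text \<open>Once the estimates are fixed, the query at a node of the tree does not depend on the
  sample, so the bound \<open>p\<close> for a fixed query applies there; \<open>branch_count\<close>
  adds up the nodes.\<close>

lemma nn_integral_miss_le:
  fixes P :: "'s pmf"
  assumes p: "\<And>q. q \<in> queries N \<Longrightarrow> emeasure (measure_pmf P) {S. q \<in> B S} \<le> p"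
    and R: "real (card levels) \<le> R"
    and "length h + j \<le> T" and "\<forall>(q, a) \<in> set h. q \<in> queries N"
  shows "(\<integral>\<^sup>+S. miss (B S) j k G h \<partial>measure_pmf P) \<le> ennreal (branch_count R j k) * p"
  using assms(3,4)
proof (induction j arbitrary: k G h)
  case (Suc j)
  let ?q = "f h"
  have q: "?q \<in> queries N"
    using Suc.prems by (intro ask_queries) (auto simp: inputs_def)
  have R0: "R \<ge> 0"
    using R by linarith
  note bc = branch_count_nonneg[OF R0]
  have IH: "(\<integral>\<^sup>+S. miss (B S) j k' G' (h @ [(?q, a)]) \<partial>measure_pmf P) \<le> ennreal (branch_count R j k') * p" for k' G' a
    using Suc.prems q by (intro Suc.IH) auto
  have branch: "(\<integral>\<^sup>+S. (if k = 0 then 0 else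
       \<Sum>r\<in>levels. miss (B S) j (k - 1) (G' r) (h @ [(?q, r)])) \<partial>measure_pmf P)
      \<le> ennreal (if k = 0 then 0 else R * branch_count R j (k - 1)) * p" for G'
  proof (cases "k = 0")
    case False
    have "(\<integral>\<^sup>+S. (\<Sum>r\<in>levels. miss (B S) j (k - 1) (G' r) (h @ [(?q, r)])) \<partial>measure_pmf P)
       \<le> (\<Sum>r\<in>levels. ennreal (branch_count R j (k - 1)) * p)"
      by (subst nn_integral_sum) (auto intro!: sum_mono IH simp del: sum_constant)
    also have "\<dots> = ennreal (real (card levels)) * (ennreal (branch_count R j (k - 1)) * p)"
      by (simp add: ennreal_of_nat_eq_real_of_nat)
    also have "\<dots> \<le> ennreal R * (ennreal (branch_count R j (k - 1)) * p)"
      by (intro mult_right_mono ennreal_leI R) auto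
    finally show ?thesis
      using False R0 bc by (simp add: ennreal_mult mult.assoc)
  qed simp
  have "(\<integral>\<^sup>+S. miss (B S) (Suc j) k G h \<partial>measure_pmf P) =
     (\<integral>\<^sup>+S. indicator {S. ?q \<in> B S} S \<partial>measure_pmf P) +
     (\<integral>\<^sup>+u. (\<integral>\<^sup>+S. miss (B S) j k G (h @ [(?q, u / l)]) \<partial>measure_pmf P) +
        (\<integral>\<^sup>+S. (if k = 0 then 0 else
           \<Sum>r\<in>levels. miss (B S) j (k - 1) (add_mset (update (u - l * r) ?q) G) (h @ [(?q, r)])) \<partial>measure_pmf P)
        \<partial>measure_pmf (est ?q G))"
    by (simp add: nn_integral_add nn_integral_measure_pmf_swap[where Q = "est ?q G"] indicator_def
        cong: if_cong)
  also have "\<dots> \<le> p + (\<integral>\<^sup>+u. ennreal (branch_count R j k) * p +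
       ennreal (if k = 0 then 0 else R * branch_count R j (k - 1)) * p \<partial>measure_pmf (est ?q G))"
    using p[OF q] by (intro add_mono nn_integral_mono IH branch) auto
  also have "\<dots> = ennreal 1 * p + (ennreal (branch_count R j k) * p +
       ennreal (if k = 0 then 0 else R * branch_count R j (k - 1)) * p)"
    by (simp add: measure_pmf.emeasure_space_1)
  also have "\<dots> = ennreal (branch_count R (Suc j) k) * p"
    using bc R0 by (simp add: ennreal_plus distrib_right add.assoc del: ennreal_plus[symmetric])
  finally show ?case .
qed simp

text \<open>In an update round the direction of the update can be read off the rounded answer, so it does
  not multiply the number of branches.\<close>
lemma sign_pm_round:
  assumes "\<bar>u - l * x\<bar> > l * e / 2"
  shows "sign_pm (u - l * round_to (e / 2) x) = sign_pm (u - l * x)"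
proof -
  have "\<bar>l * round_to (e / 2) x - l * x\<bar> = l * \<bar>round_to (e / 2) x - x\<bar>"
    using l_pos by (simp add: abs_mult flip: right_diff_distrib)
  also have "\<dots> \<le> l * (e / 2 / 2)"
    using l_pos e_pos by (intro mult_left_mono abs_round_to_diff_le) auto
  moreover have "l * e > 0"
    using l_pos e_pos by simp
  ultimately show ?thesis
    using assms by (auto simp: sign_pm_def abs_if split: if_splits)
qed

text \<open>For a fixed sample, a wrong answer is charged either to a bad estimate, at cost
  \<open>\<beta>\<close> per round, or to a query from \<open>B\<close> on the path, counted by
  \<open>miss\<close>. In \<open>Inv j k G\<close>, \<open>j\<close> rounds and \<open>k\<close>
  updates are left.\<close>

lemma play_error_le:
  assumes S: "set_mset S \<subseteq> {1..N}"
    and cap: "\<And>j k G. Inv (Suc j) k G \<Longrightarrow> real (size G) \<le> 128 * (1 / (l * e)\<^sup>2)"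
    and good: "\<And>j k G q. Inv (Suc j) k G \<Longrightarrow> q \<in> f ` inputs N T \<Longrightarrow>
        emeasure (measure_pmf (est q G)) {u. \<not> good G q u} \<le> \<beta>"
    and skip: "\<And>j k G q u. Inv (Suc j) k G \<Longrightarrow> q \<in> f ` inputs N T \<Longrightarrow> q \<notin> B \<Longrightarrow> good G q u \<Longrightarrow>
        \<bar>u - l * sample_mean S q\<bar> \<le> l * e / 2 \<Longrightarrow> Inv j k G \<and> \<bar>u / l - dist_mean D q\<bar> \<le> e"
    and step: "\<And>j k G q u. Inv (Suc j) k G \<Longrightarrow> q \<in> f ` inputs N T \<Longrightarrow> q \<notin> B \<Longrightarrow> good G q u \<Longrightarrow>
        \<bar>u - l * sample_mean S q\<bar> > l * e / 2 \<Longrightarrow>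
        k > 0 \<and> Inv j (k - 1) (add_mset (update (u - l * sample_mean S q) q) G) \<and>
        \<bar>round_to (e / 2) (sample_mean S q) - dist_mean D q\<bar> \<le> e"
    and "Inv j k G" and "length h + j \<le> T"
    and "\<forall>(q, a) \<in> set h. q \<in> queries N \<and> \<bar>a - dist_mean D q\<bar> \<le> e"
  shows "emeasure (measure_pmf (play (aqa_ogd N T e d l) f j (S, G) h))
      {h'. \<exists>(q, a) \<in> set h'. \<not> \<bar>a - dist_mean D q\<bar> \<le> e}
    \<le> of_nat j * \<beta> + miss B j k G h"
  using assms(6-8)
proof (induction j arbitrary: k G h)
  case 0
  then show ?case
    by (auto simp: indicator_def)
next
  case (Suc j)
  let ?q = "f h" and ?E = "{h'. \<exists>(q, a) \<in> set h'. \<not> \<bar>a - dist_mean D q\<bar> \<le> e}"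
  let ?m = "aqa_ogd N T e d l" and ?sm = "sample_mean S (f h)"
  have h: "h \<in> inputs N T"
    using Suc.prems by (auto simp: inputs_def)
  then have q: "?q \<in> queries N" "?q \<in> f ` inputs N T"
    by (auto intro: ask_queries)
  let ?g = "\<lambda>u. miss B j k G (h @ [(?q, u / l)]) + (if k = 0 then 0 else
       \<Sum>r\<in>levels. miss B j (k - 1) (add_mset (update (u - l * r) ?q) G) (h @ [(?q, r)]))"
  let ?next = "\<lambda>u. if \<bar>u - l * ?sm\<bar> > l * e / 2
     then (round_to (e / 2) ?sm, (S, add_mset (update (u - l * ?sm) ?q) G)) else (u / l, (S, G))"
  show ?case
  proof (cases "?q \<in> B")
    case True
    \<comment> \<open>A query from \<open>B\<close> at the root already makes the bound
      trivial.\<close>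
    then have "1 \<le> miss B (Suc j) k G h"
      by simp
    then show ?thesis
      by (meson add_increasing measure_pmf.emeasure_le_1 order_trans zero_le)
  next
    case False
    \<comment> \<open>By \<open>cap\<close> the size test succeeds, so the threshold test alone
      decides about an update.\<close>
    have eq: "answer ?m (S, G) ?q = map_pmf ?next (est ?q G)"
      using cap[OF Suc.prems(1)] unfolding aqa_ogd_def
      by (auto simp: Let_def update_def fun_eq_iff intro!: map_pmf_cong)
    have "emeasure (measure_pmf (play ?m f j (snd (?next u)) (h @ [(?q, fst (?next u))]))) ?E
        \<le> indicator {u. \<not> good G ?q u} u + (of_nat j * \<beta> + ?g u)" for u
    proof (cases "good G ?q u")
      case True
      note inv = Suc.prems(1) q(2) \<open>?q \<notin> B\<close> True
      have ind: "indicator {u. \<not> good G ?q u} u = (0 :: ennreal)"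
        using True by simp
      show ?thesis
      proof (cases "\<bar>u - l * ?sm\<bar> > l * e / 2")
        case upd: True
        note st = step[OF inv upd]
        let ?r = "round_to (e / 2) ?sm"
        have "emeasure (measure_pmf (play ?m f j (snd (?next u)) (h @ [(?q, fst (?next u))]))) ?E
          \<le> of_nat j * \<beta> + miss B j (k - 1) (add_mset (update (u - l * ?sm) ?q) G) (h @ [(?q, ?r)])"
          using upd st Suc.prems q(1) by (auto intro!: Suc.IH)
        also have "of_nat j * \<beta> + miss B j (k - 1) (add_mset (update (u - l * ?sm) ?q) G) (h @ [(?q, ?r)])
            \<le> of_nat j * \<beta> + ?g u"
        proof -
          \<comment> \<open>The state actually reached is thus one of the branches indexed by
            \<open>levels\<close>, and its term is dominated by the whole sum.\<close>
          have "update (u - l * ?sm) ?q = update (u - l * ?r) ?q"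
            using sign_pm_round[OF upd] by (simp add: update_def fun_eq_iff)
          moreover
          have "?r \<in> levels"
            using abs_sample_mean_le[OF S q(1)] by (auto simp: levels_def abs_le_iff)
          then have "miss B j (k - 1) (add_mset (update (u - l * ?r) ?q) G) (h @ [(?q, ?r)])
            \<le> (\<Sum>r\<in>levels. miss B j (k - 1) (add_mset (update (u - l * r) ?q) G) (h @ [(?q, r)]))"
            using levels_card(1) by (intro member_le_sum) auto
          ultimately show ?thesis
            using st by (intro add_left_mono) (simp add: add_increasing)
        qed
        finally show ?thesis
          by (simp only: ind add_0_left)
      next
        case nupd: False
        then have sk: "Inv j k G" "\<bar>u / l - dist_mean D ?q\<bar> \<le> e"
          using skip[OF inv] by auto
        have "emeasure (measure_pmf (play ?m f j (snd (?next u)) (h @ [(?q, fst (?next u))]))) ?E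
          \<le> of_nat j * \<beta> + miss B j k G (h @ [(?q, u / l)])"
          using nupd sk Suc.prems q(1) by (auto intro!: Suc.IH)
        also have "\<dots> \<le> of_nat j * \<beta> + ?g u"
          by (intro add_left_mono) simp
        finally show ?thesis
          by (simp only: ind add_0_left)
      qed
    next
      case False
      then show ?thesis
        by (auto intro: order_trans[OF measure_pmf.emeasure_le_1])
    qed
    note next_le = this
    have int: "(\<integral>\<^sup>+u. indicator X u + (c + F u) \<partial>measure_pmf P)
        = emeasure (measure_pmf P) X + (c + (\<integral>\<^sup>+u. F u \<partial>measure_pmf P))" for X c F and P :: "real pmf"
      by (simp add: nn_integral_add measure_pmf.emeasure_space_1)
    from next_le have "emeasure (measure_pmf (play ?m f (Suc j) (S, G) h)) ?E
       \<le> (\<integral>\<^sup>+u. indicator {u. \<not> good G ?q u} u + (of_nat j * \<beta> + ?g u) \<partial>measure_pmf (est ?q G))"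
      unfolding play.simps eq by (simp only: emeasure_bind_pmf nn_integral_map_pmf case_prod_unfold)
        (intro nn_integral_mono)
    also have "\<dots> = emeasure (measure_pmf (est ?q G)) {u. \<not> good G ?q u} + (of_nat j * \<beta> + (\<integral>\<^sup>+u. ?g u \<partial>measure_pmf (est ?q G)))"
      by (rule int)
    also have "\<dots> \<le> \<beta> + (of_nat j * \<beta> + (\<integral>\<^sup>+u. ?g u \<partial>measure_pmf (est ?q G)))"
      by (intro add_right_mono good[OF Suc.prems(1) q(2)])
    finally show ?thesis
      using False by (simp add: distrib_right add.assoc)
  qed
qed

text \<open>The average of \<open>play_error_le\<close> over the sample. Each regime below supplies
  its own invariant, notion of good estimate and set of bad queries.\<close>

lemma transcript_error_le:
  assumes D: "set_pmf D \<subseteq> {1..N}"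
    and cap: "\<And>j k G. Inv (Suc j) k G \<Longrightarrow> real (size G) \<le> 128 * (1 / (l * e)\<^sup>2)"
    and good: "\<And>j k G q. Inv (Suc j) k G \<Longrightarrow> q \<in> f ` inputs N T \<Longrightarrow>
        emeasure (measure_pmf (est q G)) {u. \<not> good G q u} \<le> \<beta>"
    and skip: "\<And>S j k G q u. set_mset S \<subseteq> {1..N} \<Longrightarrow> Inv (Suc j) k G \<Longrightarrow> q \<in> f ` inputs N T \<Longrightarrow> q \<notin> B S \<Longrightarrow> good G q u \<Longrightarrow>
        \<bar>u - l * sample_mean S q\<bar> \<le> l * e / 2 \<Longrightarrow> Inv j k G \<and> \<bar>u / l - dist_mean D q\<bar> \<le> e"
    and step: "\<And>S j k G q u. set_mset S \<subseteq> {1..N} \<Longrightarrow> Inv (Suc j) k G \<Longrightarrow> q \<in> f ` inputs N T \<Longrightarrow> q \<notin> B S \<Longrightarrow> good G q u \<Longrightarrow>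
        \<bar>u - l * sample_mean S q\<bar> > l * e / 2 \<Longrightarrow>
        k > 0 \<and> Inv j (k - 1) (add_mset (update (u - l * sample_mean S q) q) G) \<and>
        \<bar>round_to (e / 2) (sample_mean S q) - dist_mean D q\<bar> \<le> e"
    and init: "Inv T k {#}"
    and p: "\<And>q. q \<in> queries N \<Longrightarrow> emeasure (measure_pmf (replicate_pmf M D)) {xs. q \<in> B (mset xs)} \<le> p"
    and R: "4 / e + 2 \<le> R"
  shows "emeasure (measure_pmf (transcript T M (aqa_ogd N T e d l) D f))
      {h. \<not> (\<forall>t<T. \<bar>snd (h ! t) - dist_mean D (fst (h ! t))\<bar> \<le> e)}
    \<le> of_nat T * \<beta> + ennreal (branch_count R T k) * p"
proof -
  let ?m = "aqa_ogd N T e d l" and ?P = "measure_pmf (replicate_pmf M D)"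
  let ?E = "{h'. \<exists>(q, a) \<in> set h'. \<not> \<bar>a - dist_mean D q\<bar> \<le> e}"
  have "emeasure (measure_pmf (transcript T M ?m D f)) {h. \<not> (\<forall>t<T. \<bar>snd (h ! t) - dist_mean D (fst (h ! t))\<bar> \<le> e)}
      \<le> emeasure (measure_pmf (transcript T M ?m D f)) ?E"
  proof (rule emeasure_mono_AE)
    \<comment> \<open>This makes every index \<open>t < T\<close> refer to an actual round.\<close>
    have "length h = T" if "h \<in> set_pmf (transcript T M ?m D f)" for h
      using that by (auto simp: transcript_def dest: set_pmf_play_length)
    then show "AE h in measure_pmf (transcript T M ?m D f).
        h \<in> {h. \<not> (\<forall>t<T. \<bar>snd (h ! t) - dist_mean D (fst (h ! t))\<bar> \<le> e)} \<longrightarrow> h \<in> ?E"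
      by (force simp: AE_measure_pmf_iff case_prod_unfold)
  qed simp
  also have "\<dots> = (\<integral>\<^sup>+xs. emeasure (measure_pmf (play ?m f T (mset xs, {#}) [])) ?E \<partial>?P)"
    by (simp add: transcript_def aqa_ogd_def)
  also have "\<dots> \<le> (\<integral>\<^sup>+xs. of_nat T * \<beta> + miss (B (mset xs)) T k {#} [] \<partial>?P)"
  proof (rule nn_integral_mono_AE, unfold AE_measure_pmf_iff, rule ballI)
    fix xs assume "xs \<in> set_pmf (replicate_pmf M D)"
    then have "set_mset (mset xs) \<subseteq> {1..N}"
      using D by (auto simp: set_replicate_pmf)
    from play_error_le[where Inv = Inv and good = good and B = "B (mset xs)", OF this cap good
        skip[OF this] step[OF this] init]
    show "emeasure (measure_pmf (play ?m f T (mset xs, {#}) [])) ?E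
        \<le> of_nat T * \<beta> + miss (B (mset xs)) T k {#} []"
      by simp
  qed
  also have "\<dots> = of_nat T * \<beta> + (\<integral>\<^sup>+xs. miss (B (mset xs)) T k {#} [] \<partial>?P)"
    by (simp add: nn_integral_add measure_pmf.emeasure_space_1)
  also have "\<dots> \<le> of_nat T * \<beta> + ennreal (branch_count R T k) * p"
    using p levels_card(2) R by (intro add_left_mono nn_integral_miss_le) auto
  finally show ?thesis .
qed

end

subsection \<open>Potential argument\<close>

lemma abs_dist_mean_le:
  assumes D: "set_pmf D \<subseteq> {1..N}" and q: "q \<in> queries N"
  shows "\<bar>dist_mean D q\<bar> \<le> 1"
proof -
  have "\<bar>dist_mean D q\<bar> \<le> (\<Sum>i\<in>{1..N}. \<bar>pmf D i * q i\<bar>)"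
    unfolding dist_mean_eq_sum[OF D] by (rule sum_abs)
  also have "\<dots> = (\<Sum>i\<in>{1..N}. pmf D i)"
    using queriesD(1)[OF q] by (intro sum.cong) (auto simp: abs_mult)
  also have "\<dots> = 1"
    using D by (intro sum_pmf_eq_1) auto
  finally show ?thesis .
qed

text \<open>The gradient steps aim at the vector \<open>l * N * pmf D'\<close>, scaled so that its
  \<open>inner_mean\<close> with \<open>q\<close> is \<open>l * dist_mean D' q\<close>.\<close>

definition potential :: "nat \<Rightarrow> real \<Rightarrow> nat pmf \<Rightarrow> (nat \<Rightarrow> real) multiset \<Rightarrow> real" where
  "potential N l D' G = (\<Sum>i\<in>{1..N}. (gvec G i - l * real N * pmf D' i)\<^sup>2) / real N"

lemma potential_nonneg: "potential N l D' G \<ge> 0"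
  by (simp add: potential_def sum_nonneg)

text \<open>Density puts the entries of the target vector into \<open>[0, 1]\<close>, so their
  squares sum to at most their sum \<open>l * N\<close>.\<close>

lemma potential_empty_le:
  assumes "dense N l D'" and "N > 0" and "0 < l" and "l \<le> 1"
  shows "potential N l D' {#} \<le> 1"
proof -
  have "(\<Sum>i\<in>{1..N}. (l * real N * pmf D' i)\<^sup>2) \<le> (\<Sum>i\<in>{1..N}. l * real N * pmf D' i)"
  proof (rule sum_mono)
    fix i assume "i \<in> {1..N}"
    then have "pmf D' i \<le> 1 / (l * real N)"
      using assms by (auto simp: dense_def)
    then have "l * real N * pmf D' i \<le> 1"
      using assms by (simp add: field_simps)
    moreover have "0 \<le> l * real N * pmf D' i"
      using assms by simp
    ultimately show "(l * real N * pmf D' i)\<^sup>2 \<le> l * real N * pmf D' i"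
      by (simp add: power2_eq_square mult_left_le)
  qed
  also have "\<dots> = l * real N * (\<Sum>i\<in>{1..N}. pmf D' i)"
    by (simp add: sum_distrib_left)
  also have "(\<Sum>i\<in>{1..N}. pmf D' i) = 1"
    using assms by (intro sum_pmf_eq_1) (auto simp: dense_def)
  finally have "(\<Sum>i\<in>{1..N}. (l * real N * pmf D' i)\<^sup>2) \<le> l * real N"
    by simp
  also have "\<dots> \<le> real N"
    using assms by (simp add: mult_left_le_one_le)
  finally show ?thesis
    using \<open>N > 0\<close> by (simp add: potential_def gvec_def)
qed

context aqa_game
begin

text \<open>Expanding the square of a step of size \<open>l * e / 16\<close>, the linear term gains
  at least \<open>5 / 256\<close> and the quadratic term costs \<open>1 / 256\<close>, in units of
  \<open>(l * e)\<^sup>2\<close>.\<close>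

lemma potential_update_le:
  assumes D': "set_pmf D' \<subseteq> {1..N}" and q: "q \<in> queries N" and "N > 0"
    and gap: "sign_pm z * (inner_mean N q (gvec G) - l * dist_mean D' q) \<ge> 5 / 32 * (l * e)"
  shows "potential N l D' (add_mset (update z q) G) \<le> potential N l D' G - (l * e)\<^sup>2 / 64"
proof -
  define w where "w i = gvec G i - l * real N * pmf D' i" for i
  define g where "g = l * e / 16 * sign_pm z"
  have sq: "(gvec (add_mset (update z q) G) i - l * real N * pmf D' i)\<^sup>2 = (w i)\<^sup>2 - 2 * g * (q i * w i) + g\<^sup>2"
    if "i \<in> {1..N}" for i
  proof -
    have "gvec (add_mset (update z q) G) i - l * real N * pmf D' i = w i - g * q i"
      by (simp add: gvec_def w_def update_def g_def)
    moreover have "(w i - g * q i)\<^sup>2 = (w i)\<^sup>2 - 2 * g * (q i * w i) + g\<^sup>2 * (q i * q i)"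
      by (simp add: power2_eq_square algebra_simps)
    ultimately show ?thesis
      using queriesD(2)[OF q that] by simp
  qed
  have "potential N l D' (add_mset (update z q) G)
      = (\<Sum>i\<in>{1..N}. (w i)\<^sup>2 - 2 * g * (q i * w i) + g\<^sup>2) / real N"
    unfolding potential_def by (intro arg_cong2[where f = "(/)"] sum.cong refl sq)
  also have "\<dots> = potential N l D' G - 2 * g * inner_mean N q w + g\<^sup>2"
    using \<open>N > 0\<close> by (simp add: sum.distrib sum_subtractf potential_def w_def inner_mean_def
        sum_distrib_left[symmetric] add_divide_distrib diff_divide_distrib)
  also have "g\<^sup>2 = (l * e)\<^sup>2 / 256"
    by (simp add: g_def sign_pm_def power2_eq_square)
  also have "inner_mean N q w = inner_mean N q (gvec G) - l * dist_mean D' q"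
    using \<open>N > 0\<close> by (simp add: w_def inner_mean_def dist_mean_eq_sum[OF D'] right_diff_distrib
        sum_subtractf diff_divide_distrib sum_distrib_left sum_divide_distrib mult_ac)
  also have "2 * g * (inner_mean N q (gvec G) - l * dist_mean D' q) \<ge> 5 / 256 * (l * e)\<^sup>2"
  proof -
    have "l * e / 8 * (5 / 32 * (l * e)) \<le> l * e / 8 * (sign_pm z * (inner_mean N q (gvec G) - l * dist_mean D' q))"
      using e_pos l_pos by (intro mult_left_mono gap) auto
    then show ?thesis
      by (simp add: g_def power2_eq_square mult_ac)
  qed
  ultimately show ?thesis
    by simp
qed

section \<open>Failure probability in the three regimes\<close>

lemma transcript_error_trivial:
  assumes D: "set_pmf D \<subseteq> {1..N}" and "2 \<le> e"
  shows "emeasure (measure_pmf (transcript T M (aqa_ogd N T e d l) D f))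
      {h. \<not> (\<forall>t<T. \<bar>snd (h ! t) - dist_mean D (fst (h ! t))\<bar> \<le> e)} = 0"
proof -
  \<comment> \<open>While \<open>G\<close> is empty the estimate is exactly \<open>0\<close>, and
    the threshold \<open>l * e / 2 \<ge> l\<close> is never exceeded; hence budget \<open>0\<close>
    and no bad events.\<close>
  have "emeasure (measure_pmf (transcript T M (aqa_ogd N T e d l) D f))
      {h. \<not> (\<forall>t<T. \<bar>snd (h ! t) - dist_mean D (fst (h ! t))\<bar> \<le> e)}
    \<le> of_nat T * 0 + ennreal (branch_count (4 / e + 2) T 0) * 0"
  proof (rule transcript_error_le[where Inv = "\<lambda>_ _ G. G = {#}" and good = "\<lambda>_ _ u. u = 0" and B = "\<lambda>_. {}", OF D])
    fix q and G :: "(nat \<Rightarrow> real) multiset" and j k :: nat assume "G = {#}"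
    then show "emeasure (measure_pmf (est q G)) {u. u \<noteq> 0} \<le> 0"
      by (simp add: ip_est_eq gvec_def vimage_def)
  next
    fix S :: "nat multiset" and G :: "(nat \<Rightarrow> real) multiset" and q u and j k :: nat
    assume "q \<in> f ` inputs N T" "u = (0 :: real)" "G = {#}"
    moreover from this have "\<bar>dist_mean D q\<bar> \<le> 1"
      using ask_queries by (intro abs_dist_mean_le[OF D]) auto
    ultimately show "G = {#} \<and> \<bar>u / l - dist_mean D q\<bar> \<le> e"
      using \<open>2 \<le> e\<close> by simp
  next
    fix S :: "nat multiset" and G :: "(nat \<Rightarrow> real) multiset" and q u and j k :: nat
    assume *: "set_mset S \<subseteq> {1..N}" "q \<in> f ` inputs N T" "u = 0" "l * e / 2 < \<bar>u - l * sample_mean S q\<bar>"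
    have "\<bar>sample_mean S q\<bar> \<le> 1"
      using * ask_queries by (intro abs_sample_mean_le) auto
    then have "l * \<bar>sample_mean S q\<bar> \<le> l * (e / 2)"
      using \<open>2 \<le> e\<close> l_pos by (intro mult_left_mono) auto
    then show "0 < k \<and> add_mset (update (u - l * sample_mean S q) q) G = {#} \<and>
        \<bar>round_to (e / 2) (sample_mean S q) - dist_mean D q\<bar> \<le> e"
      using * l_pos by (simp add: abs_mult)
  qed auto
  then show ?thesis by simp
qed

lemma abs_answer_le:
  assumes "\<bar>u - l * x\<bar> \<le> l * e / 2" and "\<bar>x - y\<bar> \<le> e / 2"
  shows "\<bar>u / l - y\<bar> \<le> e"
proof -
  have "u / l - x = (u - l * x) / l"
    using l_pos by (simp add: diff_divide_distrib)
  then have "\<bar>u / l - x\<bar> = \<bar>u - l * x\<bar> / l"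
    using l_pos by (simp add: abs_divide)
  also have "\<dots> \<le> e / 2"
    using assms(1) l_pos by (simp add: divide_le_eq mult_ac)
  finally show ?thesis
    using assms(2) by linarith
qed

lemma abs_round_le: "\<bar>x - y\<bar> \<le> e / 2 \<Longrightarrow> \<bar>round_to (e / 2) x - y\<bar> \<le> e"
  using abs_round_to_diff_le[of "e / 2" x] e_pos by linarith

lemma transcript_error_few_rounds:
  assumes D: "set_pmf D \<subseteq> {1..N}" and "M > 0" and T: "real T \<le> 128 / (l * e)\<^sup>2 + 1"
    and R: "4 / e + 2 \<le> R"
  shows "emeasure (measure_pmf (transcript T M (aqa_ogd N T e d l) D f))
      {h. \<not> (\<forall>t<T. \<bar>snd (h ! t) - dist_mean D (fst (h ! t))\<bar> \<le> e)}
    \<le> ennreal (branch_count R T T) * ennreal (2 * exp (- real M * (e / 2)\<^sup>2 / 2))"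
proof -
  let ?B = "\<lambda>S. {q. \<not> \<bar>sample_mean S q - dist_mean D q\<bar> \<le> e / 2}"
  \<comment> \<open>The threshold test compares the estimate with the sample itself, so an accurate
    sample makes every answer accurate and \<open>good\<close> can be trivial. Before a round
    \<open>size G \<le> T - 1\<close>, which is within the cap; the budget \<open>k \<ge> j\<close>
    cannot run out.\<close>
  have "emeasure (measure_pmf (transcript T M (aqa_ogd N T e d l) D f))
      {h. \<not> (\<forall>t<T. \<bar>snd (h ! t) - dist_mean D (fst (h ! t))\<bar> \<le> e)}
    \<le> of_nat T * 0 + ennreal (branch_count R T T) * ennreal (2 * exp (- real M * (e / 2)\<^sup>2 / 2))"
  proof (rule transcript_error_le[where Inv = "\<lambda>j k G. size G + j \<le> T \<and> j \<le> k"
        and good = "\<lambda>_ _ _. True" and B = ?B, OF D])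
    fix q assume "q \<in> queries N"
    from sample_mean_tail[OF D this \<open>M > 0\<close>, of "e / 2"] e_pos
    show "emeasure (measure_pmf (replicate_pmf M D)) {xs. q \<in> ?B (mset xs)}
        \<le> ennreal (2 * exp (- real M * (e / 2)\<^sup>2 / 2))"
      by simp
  qed (use T R abs_answer_le abs_round_le in auto)
  then show ?thesis by simp
qed

text \<open>The update vectors are bounded by \<open>l * e / 16\<close> rather than by \<open>1\<close>, which is why the batch size
  yields a better error than the nominal \<open>l * e / 8\<close>.\<close>
lemma est_error_le:
  assumes "N > 0" and q: "q \<in> queries N" and "l \<le> 1" and "e < 2" and d: "0 < d" "d < 1" and "T > 0"
    and G: "\<forall>v\<in>#G. \<forall>i\<in>{1..N}. \<bar>v i\<bar> \<le> l * e / 16" "size G \<le> T"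
  shows "emeasure (measure_pmf (est q G)) {u. \<not> \<bar>u - inner_mean N q (gvec G)\<bar> \<le> l * e / 32}
    \<le> ennreal (d / (2 * (real T)\<^sup>2))"
proof -
  let ?B = "ip_batch T (l * e / 8) (d / (2 * real T))" and ?L = "ln (4 * (real T)\<^sup>2 / d)"
  have T: "(real T)\<^sup>2 \<ge> 1"
    using \<open>T > 0\<close> by (intro one_le_power) auto
  have "4 * (real T)\<^sup>2 / d > 1"
    using T d by (simp add: less_divide_eq)
  then have L: "?L > 0"
    by simp
  have le: "0 < l * e" "l * e \<le> 2"
    using e_pos l_pos \<open>e < 2\<close> \<open>l \<le> 1\<close> mult_mono[of l 1 e 2] by simp_all
  then have "(l * e)\<^sup>2 \<le> 2\<^sup>2"
    by (intro power_mono) auto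
  then have X: "1 / (l * e)\<^sup>2 \<ge> 1 / 4"
    using le by (intro divide_left_mono) auto
  \<comment> \<open>The failure parameter \<open>d / (2 * T)\<close> gives the batch size the
    logarithm \<open>?L\<close>, and \<open>2 * exp (- ?L)\<close> is the claimed bound.\<close>
  have "2 * real T / (d / (2 * real T)) = 4 * (real T)\<^sup>2 / d"
    by (simp add: power2_eq_square)
  then have "real ?B \<ge> 0.5 * (1 / (l * e / 8)\<^sup>2) * (real T)\<^sup>2 * ?L"
    unfolding ip_batch_def by (simp only:) linarith
  also have "0.5 * (1 / (l * e / 8)\<^sup>2) * (real T)\<^sup>2 * ?L = 32 * (1 / (l * e)\<^sup>2) * ((real T)\<^sup>2 * ?L)"
    by (simp add: power_divide)
  finally have "real ?B \<ge> 32 * (1 / (l * e)\<^sup>2) * ((real T)\<^sup>2 * ?L)" .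
  moreover have "32 * (1 / (l * e)\<^sup>2) * ((real T)\<^sup>2 * ?L) \<ge> 32 * (1 / 4) * ((real T)\<^sup>2 * ?L)"
    using X L by (intro mult_right_mono mult_left_mono) auto
  ultimately have B: "real ?B \<ge> 8 * (real T)\<^sup>2 * ?L"
    by simp
  moreover have "8 * (real T)\<^sup>2 * ?L > 0"
    using L \<open>T > 0\<close> by simp
  ultimately have Bpos: "?B > 0"
    by linarith
  \<comment> \<open>The error is half the bound on the entries, so \<open>l * e\<close> cancels. The
    remaining \<open>8\<close> is covered by \<open>32 / (l * e)\<^sup>2 \<ge> 8\<close>, as
    \<open>l * e \<le> 2\<close>.\<close>
  have "real ?B * (l * e / 32)\<^sup>2 / (2 * (real T * (l * e / 16))\<^sup>2) = real ?B / (8 * (real T)\<^sup>2)"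
    using e_pos l_pos \<open>T > 0\<close> by (simp add: power_mult_distrib power_divide)
  also have "\<dots> \<ge> ?L"
    using B T by (simp add: le_divide_eq mult_ac)
  finally have "2 * exp (- real ?B * (l * e / 32)\<^sup>2 / (2 * (real T * (l * e / 16))\<^sup>2)) \<le> 2 * exp (- ?L)"
    by simp
  also have "exp (- ?L) = d / (4 * (real T)\<^sup>2)"
    using \<open>4 * (real T)\<^sup>2 / d > 1\<close> by (subst exp_minus) (simp add: exp_ln)
  finally have "2 * exp (- real ?B * (l * e / 32)\<^sup>2 / (2 * (real T * (l * e / 16))\<^sup>2)) \<le> d / (2 * (real T)\<^sup>2)"
    by simp
  then show ?thesis
    using ip_est_tail[OF \<open>N > 0\<close> q _ _ G(1,2) \<open>T > 0\<close> Bpos, of "l * e / 32"] le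
    by (auto intro: order_trans[OF _ ennreal_leI])
qed

lemma transcript_error_many_rounds:
  assumes D: "set_pmf D \<subseteq> {1..N}" and D': "dense N l D'"
    and close: "\<And>q. q \<in> f ` inputs N T \<Longrightarrow> \<bar>dist_mean D q - dist_mean D' q\<bar> \<le> e / 16"
    and "N > 0" and l: "l \<le> 1" and e: "e < 2" and d: "0 < d" "d < 1" and "T > 0" and "M > 0"
    and R: "4 / e + 2 \<le> R"
  shows "emeasure (measure_pmf (transcript T M (aqa_ogd N T e d l) D f))
      {h. \<not> (\<forall>t<T. \<bar>snd (h ! t) - dist_mean D (fst (h ! t))\<bar> \<le> e)}
    \<le> of_nat T * ennreal (d / (2 * (real T)\<^sup>2)) +
      ennreal (branch_count R T (nat \<lfloor>64 / (l * e)\<^sup>2\<rfloor>)) * ennreal (2 * exp (- real M * (e / 4)\<^sup>2 / 2))"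
proof -
  let ?B = "\<lambda>S. {q. \<not> \<bar>sample_mean S q - dist_mean D q\<bar> \<le> e / 4}"
  define K where "K = nat \<lfloor>64 / (l * e)\<^sup>2\<rfloor>"
  \<comment> \<open>The potential pays for the \<open>k\<close> updates left but not for
    \<open>k + 1\<close>. The bound \<open>K\<close> on updates implies the cap, and the last two
    conjuncts are those required by \<open>est_error_le\<close>.\<close>
  define Inv where "Inv j k G \<longleftrightarrow> potential N l D' G < real (k + 1) * ((l * e)\<^sup>2 / 64) \<and>
      size G + k \<le> K \<and> size G + j \<le> T \<and> (\<forall>v\<in>#G. \<forall>i\<in>{1..N}. \<bar>v i\<bar> \<le> l * e / 16)"
    for j k :: nat and G
  define good where "good G q u \<longleftrightarrow> \<bar>u - inner_mean N q (gvec G)\<bar> \<le> l * e / 32" for G q u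
  have le: "0 < l * e" "0 < (l * e)\<^sup>2"
    using e_pos l_pos by auto
  have K: "real K \<le> 64 / (l * e)\<^sup>2" "64 / (l * e)\<^sup>2 < real (K + 1)"
    using le unfolding K_def by (simp_all add: of_nat_nat) linarith
  show ?thesis
    unfolding K_def[symmetric]
  proof (rule transcript_error_le[where Inv = Inv and good = good and B = ?B, OF D])
    fix j k G assume "Inv (Suc j) k G"
    then have "real (size G) \<le> 64 / (l * e)\<^sup>2"
      using K(1) by (simp add: Inv_def)
    also have "\<dots> \<le> 128 * (1 / (l * e)\<^sup>2)"
      using le by (simp add: divide_right_mono)
    finally show "real (size G) \<le> 128 * (1 / (l * e)\<^sup>2)" .
  next
    fix j k G q assume "Inv (Suc j) k G" "q \<in> f ` inputs N T"
    then show "emeasure (measure_pmf (est q G)) {u. \<not> good G q u} \<le> ennreal (d / (2 * (real T)\<^sup>2))"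
      unfolding good_def Inv_def using assms ask_queries by (intro est_error_le) auto
  next
    fix S :: "nat multiset" and j k G q u
    assume "Inv (Suc j) k G" "q \<notin> ?B S" "\<bar>u - l * sample_mean S q\<bar> \<le> l * e / 2"
    then show "Inv j k G \<and> \<bar>u / l - dist_mean D q\<bar> \<le> e"
      using e_pos by (auto simp: Inv_def intro!: abs_answer_le)
  next
    fix S :: "nat multiset" and j k G q u
    assume inv: "Inv (Suc j) k G" and q: "q \<in> f ` inputs N T" and B: "q \<notin> ?B S" and good: "good G q u"
      and upd: "l * e / 2 < \<bar>u - l * sample_mean S q\<bar>"
    let ?z = "u - l * sample_mean S q" and ?G = "add_mset (update (u - l * sample_mean S q) q) G"
    have qN: "q \<in> queries N"
      using q ask_queries by auto
    \<comment> \<open>Here \<open>5 / 16 = 1 / 4 + 1 / 16\<close>, from the sample and from the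
      dense model.\<close>
    have "\<bar>sample_mean S q - dist_mean D' q\<bar> \<le> 5 / 16 * e"
    proof -
      have "\<bar>sample_mean S q - dist_mean D q\<bar> \<le> e / 4"
        using B by simp
      then show ?thesis
        using close[OF q] by linarith
    qed
    then have "l * \<bar>sample_mean S q - dist_mean D' q\<bar> \<le> l * (5 / 16 * e)"
      using l_pos by (intro mult_left_mono) auto
    then have "\<bar>l * sample_mean S q - l * dist_mean D' q\<bar> \<le> 5 / 16 * (l * e)"
      using l_pos by (simp add: abs_mult flip: right_diff_distrib)
    note near = this
    have "\<bar>u - inner_mean N q (gvec G)\<bar> \<le> l * e / 32"
      using good by (simp add: good_def)
    note near = near this upd le(1)
    \<comment> \<open>The threshold minus both errors:
      \<open>1 / 2 - 5 / 16 - 1 / 32 = 5 / 32\<close>.\<close>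
    have "sign_pm ?z * (inner_mean N q (gvec G) - l * dist_mean D' q) \<ge> 5 / 32 * (l * e)"
    proof (cases "?z \<ge> 0")
      case True
      then have "inner_mean N q (gvec G) - l * dist_mean D' q \<ge> 5 / 32 * (l * e)"
        using near by linarith
      with True show ?thesis
        by (simp add: sign_pm_def)
    next
      case False
      then have "- (inner_mean N q (gvec G) - l * dist_mean D' q) \<ge> 5 / 32 * (l * e)"
        using near by linarith
      with False show ?thesis
        by (simp add: sign_pm_def)
    qed
    from potential_update_le[OF _ qN \<open>N > 0\<close> this]
    have pot: "potential N l D' ?G \<le> potential N l D' G - (l * e)\<^sup>2 / 64"
      using D' by (simp add: dense_def)
    have "potential N l D' G < real (k + 1) * ((l * e)\<^sup>2 / 64)"
      using inv by (simp add: Inv_def)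
    then have pot': "potential N l D' ?G < real k * ((l * e)\<^sup>2 / 64)"
      using pot by (simp add: algebra_simps)
    \<comment> \<open>The strict inequality in \<open>Inv\<close> matters: an update at
      \<open>k = 0\<close> would make the potential negative.\<close>
    have k: "k > 0"
    proof (rule ccontr)
      assume "\<not> k > 0"
      then show False
        using pot' potential_nonneg[of N l D' ?G] by simp
    qed
    have "\<bar>update ?z q i\<bar> \<le> l * e / 16" if "i \<in> {1..N}" for i
      using le queriesD(1)[OF qN that] by (simp add: update_def abs_mult sign_pm_def)
    then have "Inv j (k - 1) ?G"
      using inv k pot' by (auto simp: Inv_def)
    then show "0 < k \<and> Inv j (k - 1) ?G \<and> \<bar>round_to (e / 2) (sample_mean S q) - dist_mean D q\<bar> \<le> e"
      using k B e_pos by (auto intro!: abs_round_le)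
  next
    \<comment> \<open>Rounding down in \<open>K\<close> leaves \<open>K + 1\<close> above
      \<open>64 / (l * e)\<^sup>2\<close>, so a start at potential at most \<open>1\<close>
      satisfies the strict bound.\<close>
    have "1 < real (K + 1) * ((l * e)\<^sup>2 / 64)"
      using K(2) le by (simp add: divide_less_eq)
    then show "Inv T K {#}"
      using potential_empty_le[OF D' \<open>N > 0\<close> l_pos l] by (simp add: Inv_def)
  next
    fix q assume "q \<in> queries N"
    from sample_mean_tail[OF D this \<open>M > 0\<close>, of "e / 4"] e_pos
    show "emeasure (measure_pmf (replicate_pmf M D)) {xs. q \<in> ?B (mset xs)}
        \<le> ennreal (2 * exp (- real M * (e / 4)\<^sup>2 / 2))"
      by simp
  qed (fact R)
qed

end

subsection \<open>Sample size\<close>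

text \<open>Turns the exponent into powers comparable with the branch counts; used with
  \<open>x = T / e\<close> and \<open>y = 10 / d\<close>.\<close>

lemma exp_neg_le_power:
  assumes "0 < x" "0 < y" and "z \<ge> real m * ln x + real n * ln y"
  shows "exp (- z) \<le> (1 / x) ^ m * (1 / y) ^ n"
proof -
  have "exp (- z) \<le> exp (- (real m * ln x + real n * ln y))"
    using assms by simp
  also have "\<dots> = exp (real m * ln (1 / x)) * exp (real n * ln (1 / y))"
    using assms by (simp add: ln_div flip: exp_add)
  also have "\<dots> = (1 / x) ^ m * (1 / y) ^ n"
    using assms by (simp add: exp_of_nat_mult)
  finally show ?thesis .
qed

text \<open>The Hoeffding exponent at sample accuracy \<open>e / c\<close>; \<open>c = 2\<close>
  serves few rounds and \<open>c = 4\<close> many.\<close>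

lemma scaled_sample_size:
  fixes e l :: real
  assumes "0 < e" "0 < l" "0 < c"
    and "M \<ge> 4096 / (l\<^sup>2 * e ^ 4) * L + 32 / e\<^sup>2 * Y"
  shows "M * (e / c)\<^sup>2 / 2 \<ge> 2048 / (c\<^sup>2 * (l * e)\<^sup>2) * L + 16 / c\<^sup>2 * Y"
proof -
  have "(4096 / (l\<^sup>2 * e ^ 4) * L + 32 / e\<^sup>2 * Y) * ((e / c)\<^sup>2 / 2) \<le> M * ((e / c)\<^sup>2 / 2)"
    using assms by (intro mult_right_mono) auto
  also have "(4096 / (l\<^sup>2 * e ^ 4) * L + 32 / e\<^sup>2 * Y) * ((e / c)\<^sup>2 / 2)
      = 2048 / (c\<^sup>2 * (l * e)\<^sup>2) * L + 16 / c\<^sup>2 * Y"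
    using assms by (simp add: field_simps power2_eq_square power4_eq_xxxx)
  finally show ?thesis by simp
qed

lemma few_rounds_bound:
  fixes e l d :: real
  assumes T: "T \<ge> 1" and e: "0 < e" "e < 2" "e \<le> real T" and l: "0 < l" and d: "0 < d" "d < 1"
    and few: "real T \<le> 128 / (l * e)\<^sup>2 + 1"
    and M: "real M \<ge> 4096 / (l\<^sup>2 * e ^ 4) * ln (real T / e) + 32 / e\<^sup>2 * ln (10 / d)"
  shows "branch_count (10 / e - 1) T T * (2 * exp (- real M * (e / 2)\<^sup>2 / 2)) \<le> d"
proof -
  define m where "m = T - 1"
  let ?R = "10 / e - 1" and ?C = "branch_count (10 / e - 1) T T"
  have L: "ln (real T / e) \<ge> 0"
    using e by (intro ln_ge_zero) (simp add: le_divide_eq)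
  have R: "?R \<ge> 10 / e / 2" "?R > 0"
    using e by (auto simp: field_simps)
  \<comment> \<open>As \<open>2048 / 4 = 4 * 128\<close> and
    \<open>m \<le> 128 / (l * e)\<^sup>2\<close>, there are four powers of \<open>T / e\<close> for
    each of the \<open>m\<close> rounds.\<close>
  have "2048 / (2\<^sup>2 * (l * e)\<^sup>2) \<ge> real (4 * m)"
    using few T by (simp add: m_def of_nat_diff)
  then have "real (4 * m) * ln (real T / e) \<le> 2048 / (2\<^sup>2 * (l * e)\<^sup>2) * ln (real T / e)"
    using L by (intro mult_right_mono) auto
  then have "real M * (e / 2)\<^sup>2 / 2 \<ge> real (4 * m) * ln (real T / e) + real 4 * ln (10 / d)"
    using scaled_sample_size[OF e(1) l _ M, of 2] by simp
  from exp_neg_le_power[OF _ _ this]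
  have "exp (- (real M * (e / 2)\<^sup>2 / 2)) \<le> (e / real T) ^ (4 * m) * (d / 10) ^ 4"
    using e T d by simp
  \<comment> \<open>Dividing the power bound by \<open>?R \<ge> 5 / e\<close> brings the exponent
    down from \<open>T\<close> to \<open>m\<close>, matching the powers available.\<close>
  moreover have "?C \<le> 2 * (10 / e) ^ m"
  proof -
    have "10 / e / 2 * ?C \<le> ?R * ?C"
      using R by (intro mult_right_mono branch_count_nonneg) auto
    also have "\<dots> \<le> (1 + ?R) ^ T"
      using branch_count_le_power[of ?R T T] R by linarith
    also have "\<dots> = (10 / e) ^ m * (10 / e)"
      using T by (cases T) (auto simp: m_def mult.commute)
    finally show ?thesis
      using e by (simp add: field_simps)
  qed
  ultimately have "?C * (2 * exp (- (real M * (e / 2)\<^sup>2 / 2)))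
      \<le> 2 * (10 / e) ^ m * (2 * ((e / real T) ^ (4 * m) * (d / 10) ^ 4))"
    using e by (intro mult_mono mult_left_mono) auto
  also have "\<dots> = 4 * (10 * e ^ 3 / real T ^ 4) ^ m * (d / 10) ^ 4"
  proof -
    have "(10 / e) ^ m * (e / real T) ^ (4 * m) = (10 / e * (e / real T) ^ 4) ^ m"
      by (simp only: power_mult power_mult_distrib)
    also have "10 / e * (e / real T) ^ 4 = 10 * e ^ 3 / real T ^ 4"
      using e T by (simp add: field_simps eval_nat_numeral)
    finally show ?thesis
      by (simp add: mult_ac)
  qed
  also have "\<dots> \<le> 4 * 5 * (d / 10) ^ 4"
  proof -
    have "e ^ 3 \<le> 2 ^ 3"
      using e by (intro power_mono) auto
    then have e3: "10 * e ^ 3 \<le> 80"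
      by simp
    \<comment> \<open>The base is at most \<open>80 / T ^ 4\<close>: for \<open>T = 1\<close> the
      exponent is \<open>0\<close>, for \<open>T = 2\<close> the value is at most \<open>5\<close>,
      and from \<open>T = 3\<close> on the base is below \<open>1\<close>.\<close>
    consider "T = 1" | "T = 2" | "T \<ge> 3"
      using T by linarith
    then have "(10 * e ^ 3 / real T ^ 4) ^ m \<le> 5"
    proof cases
      case 3
      then have "real T ^ 4 \<ge> 3 ^ 4"
        by (intro power_mono) auto
      then have "10 * e ^ 3 / real T ^ 4 \<le> 1"
        using e3 by (simp add: divide_le_eq)
      then have "(10 * e ^ 3 / real T ^ 4) ^ m \<le> 1"
        using e by (intro power_le_one) auto
      then show ?thesis by simp
    qed (use e3 in \<open>auto simp: m_def\<close>)
    then show ?thesis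
      using d by (intro mult_right_mono mult_left_mono) auto
  qed
  also have "\<dots> \<le> d"
  proof -
    have "d ^ 4 \<le> d ^ 1"
      using d by (intro power_decreasing) auto
    then show ?thesis
      using d by (simp add: power_divide)
  qed
  finally show ?thesis
    by simp
qed

lemma many_rounds_bound:
  fixes e l d :: real
  assumes e: "0 < e" "e < 2" and l: "0 < l" "l \<le> 1" and d: "0 < d" "d < 1"
    and many: "real T > 128 / (l * e)\<^sup>2 + 1"
    and M: "real M \<ge> 4096 / (l\<^sup>2 * e ^ 4) * ln (real T / e) + 32 / e\<^sup>2 * ln (10 / d)"
  shows "real T * (d / (2 * (real T)\<^sup>2)) + branch_count (10 / e - 1) T (nat \<lfloor>64 / (l * e)\<^sup>2\<rfloor>) *
    (2 * exp (- real M * (e / 4)\<^sup>2 / 2)) \<le> d"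
proof -
  define k where "k = nat \<lfloor>64 / (l * e)\<^sup>2\<rfloor>"
  let ?R = "10 / e - 1" and ?C = "branch_count (10 / e - 1) T k"
  have le: "0 < l * e" "l * e \<le> 2"
    using e l mult_mono[of l 1 e 2] by simp_all
  then have "(l * e)\<^sup>2 \<le> 2\<^sup>2"
    by (intro power_mono) auto
  then have "64 / (l * e)\<^sup>2 \<ge> 64 / 2\<^sup>2"
    using le by (intro divide_left_mono) auto
  then have X: "64 / (l * e)\<^sup>2 \<ge> 16"
    by simp
  then have T: "real T \<ge> 33"
    using many by simp
  have k: "real k \<le> 64 / (l * e)\<^sup>2" "k \<ge> 16"
    using X unfolding k_def by (simp_all add: of_nat_nat le_nat_iff le_floor_iff)
  have L: "ln (real T / e) \<ge> 0"
    using e T by (intro ln_ge_zero) (simp add: le_divide_eq)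
  have R: "?R \<ge> 0"
    using e by (auto simp: field_simps)
  \<comment> \<open>As \<open>2048 / 16 = 2 * 64\<close>, each update gets two powers of
    \<open>T / e\<close>: one cancels the \<open>T\<close> in its branching factor, the other makes
    the bound decay.\<close>
  have "2048 / (4\<^sup>2 * (l * e)\<^sup>2) \<ge> real (2 * k)"
    using k by simp
  then have "real (2 * k) * ln (real T / e) \<le> 2048 / (4\<^sup>2 * (l * e)\<^sup>2) * ln (real T / e)"
    using L by (intro mult_right_mono) auto
  then have "real M * (e / 4)\<^sup>2 / 2 \<ge> real (2 * k) * ln (real T / e) + real 1 * ln (10 / d)"
    using scaled_sample_size[OF e(1) l(1) _ M, of 4] by simp
  from exp_neg_le_power[OF _ _ this]
  have "exp (- (real M * (e / 4)\<^sup>2 / 2)) \<le> (e / real T) ^ (2 * k) * (d / 10)"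
    using e T d by simp
  moreover have "?C \<le> real T * (10 * real T / e) ^ k"
  proof -
    have "1 + real T * ?R \<le> 10 * real T / e"
      using T by (simp add: algebra_simps)
    moreover have "0 \<le> 1 + real T * ?R"
      using R by simp
    ultimately have "real T * (1 + real T * ?R) ^ k \<le> real T * (10 * real T / e) ^ k"
      by (intro mult_left_mono power_mono) auto
    then show ?thesis
      using branch_count_le_budget[OF R, of T k] by linarith
  qed
  ultimately have "?C * (2 * exp (- (real M * (e / 4)\<^sup>2 / 2)))
      \<le> real T * (10 * real T / e) ^ k * (2 * ((e / real T) ^ (2 * k) * (d / 10)))"
    using e by (intro mult_mono mult_left_mono) auto
  also have "\<dots> = real T * (10 * e / real T) ^ k * (d / 5)"
  proof -
    have "(10 * real T / e) ^ k * (e / real T) ^ (2 * k) = (10 * real T / e * (e / real T) ^ 2) ^ k"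
      by (simp only: power_mult power_mult_distrib)
    also have "10 * real T / e * (e / real T) ^ 2 = 10 * e / real T"
      using e T by (simp add: field_simps power2_eq_square)
    finally show ?thesis
      by (simp add: mult_ac)
  qed
  also have "\<dots> \<le> 1 * (d / 5)"
  proof -
    \<comment> \<open>Since \<open>k \<ge> 16\<close> and \<open>T \<ge> 33\<close>, the powers of
      \<open>20 / T\<close> absorb the leading factor \<open>T\<close>.\<close>
    have "(10 * e / real T) ^ k \<le> (20 / real T) ^ k"
      using e T by (intro power_mono divide_right_mono) auto
    also have "\<dots> \<le> (20 / real T) ^ 16"
      using T k by (intro power_decreasing) auto
    finally have "real T * (10 * e / real T) ^ k \<le> real T * (20 / real T) ^ 16"
      by (intro mult_left_mono) auto
    also have "\<dots> = 20 * (20 / real T) ^ 15"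
      using T by (simp add: field_simps eval_nat_numeral)
    also have "\<dots> \<le> 20 * (20 / 33) ^ 15"
      using T by (intro mult_left_mono power_mono divide_left_mono) auto
    also have "\<dots> \<le> 1"
      by (simp add: power_divide)
    finally show ?thesis
      using d by (intro mult_right_mono) auto
  qed
  finally have "?C * (2 * exp (- (real M * (e / 4)\<^sup>2 / 2))) \<le> d / 5"
    by simp
  moreover have "real T * (d / (2 * (real T)\<^sup>2)) \<le> d / 2"
    using T d by (simp add: power2_eq_square field_simps)
  ultimately show ?thesis
    using d(1) unfolding k_def minus_mult_left[symmetric] minus_divide_left[symmetric] by linarith
qed

section \<open>From fixed coins to the game\<close>

lemma finite_set_pmf_answer_aqa_ogd:
  assumes "N > 0"
  shows "finite (set_pmf (answer (aqa_ogd N T e d l) s q))"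
proof -
  have "finite (set_pmf (replicate_pmf B (pmf_of_set {1..N})))" for B
    using assms by (simp add: set_replicate_pmf finite_lists_of_length)
  then show ?thesis
    by (cases s) (simp add: aqa_ogd_def ip_est_def Let_def)
qed

text \<open>The disjunction on \<open>\<epsilon>\<close> leaves out only \<open>T = 1\<close> with
  \<open>1 < \<epsilon> < 2\<close>, where \<open>ln (T / \<epsilon>)\<close> is negative. For
  \<open>\<epsilon> \<le> T\<close> the logarithm is nonnegative, and for
  \<open>2 \<le> \<epsilon>\<close> all answers are \<open>0\<close>.\<close>

theorem theorem6:
  fixes n N T M :: nat and \<epsilon> \<delta> l :: real and A :: "'w analyst"
  assumes "N = 2 ^ n"
    and "T \<ge> 1"
    and "\<epsilon> > 0"
    and "0 < \<delta>" and "\<delta> < 1"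
    and "0 < l" and "l \<le> 1"
    and "\<epsilon> \<le> real T \<or> 2 \<le> \<epsilon>"
    and "is_analyst N T A"
    and "pseudodense_challenger N T (\<epsilon> / 16) l A"
    and "real M \<ge> 4096 / (l\<^sup>2 * \<epsilon> ^ 4) * ln (real T / \<epsilon>) + 32 / \<epsilon>\<^sup>2 * ln (10 / \<delta>)"
  shows "accurate T M \<epsilon> \<delta> (aqa_ogd N T \<epsilon> \<delta> l) A"
proof (rule accurateI[OF \<open>is_analyst N T A\<close>])
  have N: "N > 0"
    using assms by simp
  then show "finite (set_pmf (answer (aqa_ogd N T \<epsilon> \<delta> l) s q))" for s q
    by (rule finite_set_pmf_answer_aqa_ogd)
  have "AE w in coins A. pseudodense N T (\<epsilon> / 16) l A (target A w)"
    using assms by (simp add: pseudodense_challenger_def)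
  with AE_space show "AE w in coins A. measure_pmf.prob (transcript T M (aqa_ogd N T \<epsilon> \<delta> l) (target A w) (ask A w))
       {h. \<forall>t<T. \<bar>snd (h ! t) - dist_mean (target A w) (fst (h ! t))\<bar> \<le> \<epsilon>} \<ge> 1 - \<delta>"
  proof eventually_elim
    case (elim w)
    define D where "D = target A w"
    have D: "set_pmf D \<subseteq> {1..N}"
      using assms elim by (auto simp: is_analyst_def D_def)
    \<comment> \<open>The dense model may vary with the coins; it is close on all possible queries,
      hence on those of the strategy \<open>ask A w\<close>.\<close>
    obtain D' where D': "dense N l D'"
      "\<And>q. q \<in> possible_queries N T A \<Longrightarrow> \<bar>dist_mean D q - dist_mean D' q\<bar> \<le> \<epsilon> / 16"
      using elim by (auto simp: pseudodense_def D_def)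
    have possible: "q \<in> possible_queries N T A" if "q \<in> ask A w ` inputs N T" for q
      using that elim by (auto simp: possible_queries_def)
    interpret aqa_game N T \<epsilon> \<delta> l "ask A w"
    proof
      fix h assume "h \<in> inputs N T"
      then have "(\<lambda>w. ask A w h) \<in> measurable (coins A) (count_space (queries N))"
        using assms by (auto simp: is_analyst_def)
      from measurable_space[OF this elim(1)] show "ask A w h \<in> queries N"
        by simp
    qed (use assms in auto)
    let ?P = "measure_pmf (transcript T M (aqa_ogd N T \<epsilon> \<delta> l) D (ask A w))"
    let ?ok = "{h. \<forall>t<T. \<bar>snd (h ! t) - dist_mean D (fst (h ! t))\<bar> \<le> \<epsilon>}"
    let ?bad = "{h. \<not> (\<forall>t<T. \<bar>snd (h ! t) - dist_mean D (fst (h ! t))\<bar> \<le> \<epsilon>)}"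
    have "emeasure ?P ?bad \<le> ennreal \<delta>"
    proof (cases "2 \<le> \<epsilon>")
      case True
      then show ?thesis
        using transcript_error_trivial[OF D] by simp
    next
      case False
      then have \<epsilon>: "\<epsilon> < 2" "\<epsilon> \<le> real T"
        using assms by auto
      \<comment> \<open>The branching bound is weakened to \<open>10 / \<epsilon> - 1\<close>, which
        is allowed for \<open>\<epsilon> \<le> 2\<close>, so that a node has at most
        \<open>10 / \<epsilon>\<close> children in all.\<close>
      have R: "4 / \<epsilon> + 2 \<le> 10 / \<epsilon> - 1"
        using \<epsilon> assms by (simp add: field_simps)
      then have R0: "10 / \<epsilon> - 1 \<ge> 0"
        using \<open>\<epsilon> > 0\<close> \<epsilon> by simp
      note bc = branch_count_nonneg[OF R0]
      have "M > 0"
      proof -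
        have "4096 / (l\<^sup>2 * \<epsilon> ^ 4) * ln (real T / \<epsilon>) \<ge> 0"
          using assms \<epsilon> by (intro mult_nonneg_nonneg ln_ge_zero) (auto simp: le_divide_eq)
        moreover have "32 / \<epsilon>\<^sup>2 * ln (10 / \<delta>) > 0"
          using assms by (intro mult_pos_pos ln_gt_zero) (auto simp: less_divide_eq)
        ultimately show ?thesis
          using assms(11) by linarith
      qed
      show ?thesis
      proof (cases "real T \<le> 128 / (l * \<epsilon>)\<^sup>2 + 1")
        case True
        have "emeasure ?P ?bad \<le> ennreal (branch_count (10 / \<epsilon> - 1) T T *
            (2 * exp (- real M * (\<epsilon> / 2)\<^sup>2 / 2)))"
          using transcript_error_few_rounds[OF D \<open>M > 0\<close> True R] bc by (simp add: ennreal_mult)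
        also have "\<dots> \<le> ennreal \<delta>"
          using assms \<epsilon> True by (intro ennreal_leI few_rounds_bound) auto
        finally show ?thesis .
      next
        case False
        have "emeasure ?P ?bad \<le> of_nat T * ennreal (\<delta> / (2 * (real T)\<^sup>2)) +
            ennreal (branch_count (10 / \<epsilon> - 1) T (nat \<lfloor>64 / (l * \<epsilon>)\<^sup>2\<rfloor>)) *
            ennreal (2 * exp (- real M * (\<epsilon> / 4)\<^sup>2 / 2))"
          using assms \<epsilon> N possible D'(2)
          by (intro transcript_error_many_rounds[OF D D'(1) _ _ _ _ _ _ _ \<open>M > 0\<close> R]) auto
        also have "\<dots> = ennreal (real T * (\<delta> / (2 * (real T)\<^sup>2)) +
            branch_count (10 / \<epsilon> - 1) T (nat \<lfloor>64 / (l * \<epsilon>)\<^sup>2\<rfloor>) * (2 * exp (- real M * (\<epsilon> / 4)\<^sup>2 / 2)))"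
          using bc \<open>0 < \<delta>\<close> unfolding ennreal_of_nat_eq_real_of_nat
          by (subst (1 2) ennreal_mult[symmetric]) (simp_all flip: ennreal_plus)
        also have "\<dots> \<le> ennreal \<delta>"
          using assms \<epsilon> False by (intro ennreal_leI many_rounds_bound) auto
        finally show ?thesis .
      qed
    qed
    then have "measure ?P ?bad \<le> \<delta>"
      using assms by (simp add: measure_pmf.emeasure_eq_measure)
    moreover have "measure ?P ?bad = 1 - measure ?P ?ok"
      using measure_pmf.prob_compl[of ?ok "transcript T M (aqa_ogd N T \<epsilon> \<delta> l) D (ask A w)"]
      unfolding Collect_neg_eq Compl_eq_Diff_UNIV by simp
    ultimately show ?case
      by (simp add: D_def)
  qed
qed

end
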